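(* If $G$ is an unbounded abelian group, then there exists a metrizable locally quasi-convex group topology on $G$ which is not Mackey.
   Context: $\mathbb{T}$ is the unit circle group in $\mathbb{C}$ and $\mathbb{T}_+=\{z\in\mathbb{T}:\mathrm{Re}(z)\ge 0\}$. An abelian group $G$ is bounded if there is a positive integer $m$ with $mG=\{0\}$, and unbounded otherwise. For a topological abelian group $(G,\tau)$, the dual group $(G,\tau)^\wedge$ is the group of all continuous homomorphisms $(G,\tau)\to\mathbb{T}$. A subset $M\subseteq G$ is quasi-convex if for every $x\in G\setminus M$ there is $\phi\in (G,\tau)^\wedge$ with $\phi(M)\subseteq\mathbb{T}_+$ and $\phi(x)\notin\mathbb{T}_+$. The topology $\tau$ is locally quasi-convex if it has a basis of neighborhoods of $0$ consisting of quasi-convex sets; locally quasi-convex group topologies are taken to be Hausdorff. Two group topologies $\tau,\nu$ on $G$ are compatible if $(G,\tau)^\wedge=(G,\nu)^\wedge$. A locally quasi-convex group topology $\tau$ on $G$ is Mackey if $\nu\le\tau$ (that is, $\nu\subseteq\tau$) for every locally quasi-convex group topology $\nu$ on $G$ compatible with $\tau$. *)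

theory Defs
  imports "HOL-Analysis.Analysis"
begin

definition bounded_group :: "'a::ab_group_add itself \<Rightarrow> bool" where
  "bounded_group _ \<longleftrightarrow> (\<exists>m::nat. m > 0 \<and> (\<forall>x::'a. (\<Sum>i<m. x) = 0))"

definition circle :: "complex set" where
  "circle = sphere 0 1"

definition circle_plus :: "complex set" where
  "circle_plus = {z \<in> circle. Re z \<ge> 0}"

text \<open>
  Topologies are explicit objects rather than type class instances, since different
  topologies on the same group have to be compared.
\<close>

definition group_topology :: "'a::ab_group_add topology \<Rightarrow> bool" where
  "group_topology \<tau> \<longleftrightarrow>
     topspace \<tau> = UNIV \<and>
     continuous_map (prod_topology \<tau> \<tau>) \<tau> (\<lambda>(x, y). x + y) \<and>
     continuous_map \<tau> \<tau> uminus"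

text \<open>
  Only the underlying set of the dual is recorded: its operation is pointwise
  multiplication, whatever the topology, so equality of dual groups is equality of these sets.
\<close>

definition dual_group :: "'a::ab_group_add topology \<Rightarrow> ('a \<Rightarrow> complex) set" where
  "dual_group \<tau> =
     {\<phi>. continuous_map \<tau> (top_of_set circle) \<phi> \<and> (\<forall>x y. \<phi> (x + y) = \<phi> x * \<phi> y)}"

definition quasi_convex :: "'a::ab_group_add topology \<Rightarrow> 'a set \<Rightarrow> bool" where
  "quasi_convex \<tau> M \<longleftrightarrow>
     (\<forall>x. x \<notin> M \<longrightarrow> (\<exists>\<phi>\<in>dual_group \<tau>. \<phi> ` M \<subseteq> circle_plus \<and> \<phi> x \<notin> circle_plus))"

definition locally_quasi_convex :: "'a::ab_group_add topology \<Rightarrow> bool" where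
  "locally_quasi_convex \<tau> \<longleftrightarrow>
     group_topology \<tau> \<and> Hausdorff_space \<tau> \<and>
     neighbourhood_base_at 0 (quasi_convex \<tau>) \<tau>"

definition compatible :: "'a::ab_group_add topology \<Rightarrow> 'a topology \<Rightarrow> bool" where
  "compatible \<tau> \<nu> \<longleftrightarrow> dual_group \<tau> = dual_group \<nu>"

definition Mackey :: "'a::ab_group_add topology \<Rightarrow> bool" where
  "Mackey \<tau> \<longleftrightarrow>
     locally_quasi_convex \<tau> \<and>
     (\<forall>\<nu>. locally_quasi_convex \<nu> \<and> compatible \<nu> \<tau> \<longrightarrow> (\<forall>U. openin \<nu> U \<longrightarrow> openin \<tau> U))"

end

theory Submission
  imports Defs
begin

text \<open>
  Let \<open>H\<close> be a subgroup and \<open>c n\<close> characters with \<open>c n x \<longlonglongrightarrow> 1\<close> on \<open>H\<close> which separate the points of \<open>H\<close>,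
  so that \<open>H\<close> embeds both into the product of circles and into the group \<open>c\<^sub>0\<close> of null sequences
  in the circle. Declaring \<open>H\<close> open, both embeddings induce metrizable locally quasi-convex topologies
  on the whole group. The dual of \<open>c\<^sub>0\<close> only contains finite products of coordinates, so if the image of
  \<open>H\<close> is large enough, the strictly finer \<open>c\<^sub>0\<close>-topology has no further continuous characters and the
  product topology is not Mackey.

  If some \<open>x\<close> has infinite order, take \<open>H\<close> generated by \<open>x\<close> and \<open>c n x = cis (2 * pi / fact n)\<close>.
  Otherwise the group is torsion and there is an increasing chain of subgroups \<open>Hs n\<close>, each obtained from
  the previous one by adjoining an element \<open>xs n\<close> of order \<open>qs n > n\<close> modulo \<open>Hs n\<close>. A character
  of \<open>Hs n\<close> extends to \<open>xs n\<close> with a value within \<open>2 * pi / qs n\<close> of any prescribed point, which is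
  enough freedom to make the image of \<open>H\<close> dense in \<open>c\<^sub>0\<close>.
\<close>

subsection \<open>Integer multiples and characters\<close>

text \<open>At most one of the two sums is nonempty, because \<open>nat\<close> truncates at 0. For
  \<open>k = int m\<close> this is the sum in \<open>bounded_group\<close>.\<close>

definition zmul :: "int \<Rightarrow> 'a::ab_group_add \<Rightarrow> 'a" where
  "zmul k x = (\<Sum>i<nat k. x) - (\<Sum>i<nat (- k). x)"

definition subgrp :: "'a::ab_group_add set \<Rightarrow> bool" where
  "subgrp H \<longleftrightarrow> 0 \<in> H \<and> (\<forall>x\<in>H. \<forall>y\<in>H. x - y \<in> H)"

text \<open>An algebraic notion only: the continuous characters are singled out later, separately
  for each topology.\<close>

definition character :: "('a::ab_group_add \<Rightarrow> complex) \<Rightarrow> bool" where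
  "character \<phi> \<longleftrightarrow> (\<forall>x. norm (\<phi> x) = 1) \<and> (\<forall>x y. \<phi> (x + y) = \<phi> x * \<phi> y)"

lemma zmul_0 [simp]: "zmul 0 x = 0" and zmul_1 [simp]: "zmul 1 x = x"
  by (auto simp: zmul_def)

lemma zmul_of_nat: "zmul (int n) x = (\<Sum>i<n. x)"
  by (simp add: zmul_def)

lemma zmul_Suc: "zmul (k + 1) x = zmul k x + x"
proof (cases "k \<ge> 0")
  case True
  then have "nat (k + 1) = Suc (nat k)" "nat (- k) = 0" "nat (- (k + 1)) = 0" by auto
  then show ?thesis unfolding zmul_def by simp
next
  case False
  then have "nat (- k) = Suc (nat (- (k + 1)))" "nat k = 0" "nat (k + 1) = 0" by auto
  then show ?thesis unfolding zmul_def by simp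
qed

lemma zmul_add: "zmul (a + b) x = zmul a x + zmul b x"
proof (induction b rule: int_induct[where k = 0])
  case (step1 i)
  then show ?case using zmul_Suc[of "a + i" x] zmul_Suc[of i x] by (simp add: add.assoc)
next
  case (step2 i)
  then show ?case using zmul_Suc[of "a + (i - 1)" x] zmul_Suc[of "i - 1" x]
    by (simp add: algebra_simps)
qed simp

lemma zmul_minus: "zmul (- a) x = - zmul a x"
  using zmul_add[of a "- a" x] by (simp add: eq_neg_iff_add_eq_0 add.commute)

lemma zmul_diff: "zmul (a - b) x = zmul a x - zmul b x"
  using zmul_add[of a "- b" x] by (simp add: zmul_minus)

lemma zmul_right_add: "zmul a (x + y) = zmul a x + zmul a y"
proof (induction a rule: int_induct[where k = 0])
  case (step1 i)
  then show ?case by (simp only: zmul_Suc) (simp add: algebra_simps)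
next
  case (step2 i)
  then show ?case
    using zmul_Suc[of "i - 1" x] zmul_Suc[of "i - 1" y] zmul_Suc[of "i - 1" "x + y"]
    by (simp add: algebra_simps)
qed simp

lemma zmul_zmul: "zmul a (zmul b x) = zmul (a * b) x"
proof (induction a rule: int_induct[where k = 0])
  case (step1 i)
  then show ?case by (simp add: zmul_Suc algebra_simps zmul_add)
next
  case (step2 i)
  then show ?case using zmul_Suc[of "i - 1" "zmul b x"]
    by (simp add: algebra_simps zmul_diff)
qed simp

lemma zmul_zero_right [simp]: "zmul a 0 = 0"
  using zmul_right_add[of a 0 0] by simp

lemma subgrp_0: "subgrp H \<Longrightarrow> 0 \<in> H"
  and subgrp_diff: "subgrp H \<Longrightarrow> x \<in> H \<Longrightarrow> y \<in> H \<Longrightarrow> x - y \<in> H"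
  by (auto simp: subgrp_def)

lemma subgrp_minus: "subgrp H \<Longrightarrow> x \<in> H \<Longrightarrow> - x \<in> H"
  using subgrp_diff[of H 0 x] by (simp add: subgrp_0)

lemma subgrp_add: "subgrp H \<Longrightarrow> x \<in> H \<Longrightarrow> y \<in> H \<Longrightarrow> x + y \<in> H"
  using subgrp_diff[of H x "- y"] by (simp add: subgrp_minus)

lemma subgrp_zmul:
  assumes "subgrp H" "x \<in> H" shows "zmul k x \<in> H"
proof (induction k rule: int_induct[where k = 0])
  case base
  then show ?case using assms by (simp add: subgrp_0)
next
  case (step1 i)
  then show ?case using assms by (simp add: zmul_Suc subgrp_add)
next
  case (step2 i)
  then show ?case using assms by (simp add: zmul_diff subgrp_diff)
qed

lemma character_norm: "character \<phi> \<Longrightarrow> norm (\<phi> x) = 1"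
  and character_add: "character \<phi> \<Longrightarrow> \<phi> (x + y) = \<phi> x * \<phi> y"
  by (auto simp: character_def)

lemma character_nonzero: "character \<phi> \<Longrightarrow> \<phi> x \<noteq> 0"
  using character_norm[of \<phi> x] by auto

lemma character_0: "character \<phi> \<Longrightarrow> \<phi> 0 = 1"
  using character_add[of \<phi> 0 0] character_nonzero[of \<phi> 0] by simp

lemma character_minus: "character \<phi> \<Longrightarrow> \<phi> (- x) = inverse (\<phi> x)"
  using character_add[of \<phi> x "- x"] character_nonzero[of \<phi> x]
  by (simp add: character_0 field_simps)

lemma character_diff: "character \<phi> \<Longrightarrow> \<phi> (x - y) = \<phi> x / \<phi> y"
  using character_add[of \<phi> x "- y"] by (simp add: character_minus divide_inverse)

lemma character_zmul:
  assumes "character \<phi>" shows "\<phi> (zmul k x) = \<phi> x powi k"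
proof (induction k rule: int_induct[where k = 0])
  case base
  then show ?case using assms by (simp add: character_0)
next
  case (step1 i)
  then show ?case using assms
    by (simp add: zmul_Suc character_add power_int_add character_nonzero)
next
  case (step2 i)
  then show ?case using assms
    by (simp add: zmul_diff character_diff power_int_diff character_nonzero)
qed

text \<open>Multiplication by a number of modulus 1 is an isometry, so estimates near the identity
  transfer to any pair of points.\<close>

lemma character_diff_1:
  assumes "character \<phi>" shows "norm (\<phi> (x - y) - 1) = norm (\<phi> x - \<phi> y)"
proof -
  have "\<phi> (x - y) - 1 = (\<phi> x - \<phi> y) / \<phi> y"
    using assms by (simp add: character_diff character_nonzero diff_divide_distrib)
  then show ?thesis using assms by (simp add: norm_divide character_norm)
qed

lemma character_minus_1:
  assumes "character \<phi>" shows "norm (\<phi> (- x) - 1) = norm (\<phi> x - 1)"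
  using character_diff_1[OF assms, of 0 x] assms by (simp add: character_0 norm_minus_commute)

lemma character_add_1:
  assumes "character \<phi>" shows "norm (\<phi> (x + y) - 1) \<le> norm (\<phi> x - 1) + norm (\<phi> y - 1)"
proof -
  have "norm (\<phi> (x + y) - 1) = norm ((\<phi> x - 1) - (\<phi> (- y) - 1))"
    using character_diff_1[OF assms, of x "- y"] by simp
  also have "\<dots> \<le> norm (\<phi> x - 1) + norm (\<phi> (- y) - 1)" by (rule norm_triangle_ineq4)
  finally show ?thesis using assms by (simp add: character_minus_1)
qed

lemma character_power:
  assumes "character \<phi>" shows "character (\<lambda>x. \<phi> x ^ m)"
  using assms by (auto simp: character_def norm_power power_mult_distrib)

subsection \<open>Extending characters\<close>

text \<open>A character of a subgroup is represented by its graph, a subgroup of the product with the circle.\<close>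

definition char_graph :: "('a::ab_group_add \<times> complex) set \<Rightarrow> bool" where
  "char_graph R \<longleftrightarrow> (0, 1) \<in> R \<and> (\<forall>(x, z)\<in>R. norm z = 1) \<and>
     (\<forall>(x, z)\<in>R. \<forall>(y, w)\<in>R. (x - y, z / w) \<in> R) \<and> (\<forall>z. (0, z) \<in> R \<longrightarrow> z = 1)"

lemma char_graphD:
  assumes "char_graph R"
  shows "(0, 1) \<in> R" "(x, z) \<in> R \<Longrightarrow> norm z = 1"
    "(x, z) \<in> R \<Longrightarrow> (y, w) \<in> R \<Longrightarrow> (x - y, z / w) \<in> R" "(0, z) \<in> R \<Longrightarrow> z = 1"
  using assms by (fastforce simp: char_graph_def)+

lemma char_graph_unique:
  assumes R: "char_graph R" and "(x, z) \<in> R" "(x, w) \<in> R" shows "z = w"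
proof -
  have "z / w = 1" by (rule char_graphD(4)[OF R]) (use char_graphD(3)[OF R assms(2,3)] in simp)
  then show ?thesis by (cases "w = 0") auto
qed

lemma char_graph_subgrp: "char_graph R \<Longrightarrow> subgrp (Domain R)"
  using char_graphD(1,3) by (fastforce simp: subgrp_def)

lemma char_graph_trivial: "subgrp H \<Longrightarrow> char_graph (H \<times> {1})"
  by (auto simp: char_graph_def subgrp_def)

lemma char_graph_Union:
  assumes "C \<noteq> {}" "\<And>R. R \<in> C \<Longrightarrow> char_graph R" "subset.chain UNIV C"
  shows "char_graph (\<Union>C)"
proof -
  have "(x - y, z / w) \<in> \<Union>C" if xz: "(x, z) \<in> \<Union>C" and yw: "(y, w) \<in> \<Union>C" for x y z w
  proof -
    obtain R S where "R \<in> C" "S \<in> C" "(x, z) \<in> R" "(y, w) \<in> S" using xz yw by blast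
    moreover have "R \<subseteq> S \<or> S \<subseteq> R"
      using assms(3) \<open>R \<in> C\<close> \<open>S \<in> C\<close> by (auto simp: subset.chain_def)
    ultimately show ?thesis using char_graphD(3)[OF assms(2)] by (meson UnionI subsetD)
  qed
  moreover have "(0, 1) \<in> \<Union>C" using assms(1) char_graphD(1)[OF assms(2)] by auto
  moreover have "\<forall>(x, z)\<in>\<Union>C. norm z = 1" using char_graphD(2)[OF assms(2)] by auto
  moreover have "\<forall>z. (0, z) \<in> \<Union>C \<longrightarrow> z = 1" using char_graphD(4)[OF assms(2)] by auto
  ultimately show ?thesis unfolding char_graph_def by blast
qed

definition span1 :: "'a::ab_group_add set \<Rightarrow> 'a \<Rightarrow> 'a set" where
  "span1 H x = {h + zmul k x | h k. h \<in> H}"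

lemma subgrp_span1:
  assumes H: "subgrp H" shows "subgrp (span1 H x)"
  unfolding subgrp_def
proof (intro conjI ballI)
  show "0 \<in> span1 H x" using subgrp_0[OF H]
    unfolding span1_def by (metis (mono_tags, lifting) CollectI add.right_neutral zmul_0)
  fix a b assume "a \<in> span1 H x" "b \<in> span1 H x"
  then obtain h k g l where "a = h + zmul k x" "b = g + zmul l x" "h \<in> H" "g \<in> H"
    unfolding span1_def by auto
  then have "a - b = (h - g) + zmul (k - l) x" "h - g \<in> H"
    using H by (auto simp: zmul_diff subgrp_diff)
  then show "a - b \<in> span1 H x" unfolding span1_def by blast
qed

lemma span1_superset: "H \<subseteq> span1 H x"
proof
  fix h assume "h \<in> H"
  then have "h + zmul 0 x \<in> span1 H x" unfolding span1_def by blast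
  then show "h \<in> span1 H x" by simp
qed

lemma span1_mem: "0 \<in> H \<Longrightarrow> x \<in> span1 H x"
proof -
  assume "0 \<in> H"
  then have "0 + zmul 1 x \<in> span1 H x" unfolding span1_def by blast
  then show ?thesis by simp
qed

text \<open>The value at \<open>h + zmul k x\<close> has to be \<open>z * w powi k\<close>. The
  hypothesis \<open>comp\<close> says that this agrees with \<open>R\<close> on the multiples of
  \<open>x\<close> already in the domain, which makes the extension single-valued.\<close>

lemma char_graph_extend:
  assumes R: "char_graph R" and w: "norm w = 1"
    and comp: "\<And>k z. (zmul k x, z) \<in> R \<Longrightarrow> z = w powi k"
  obtains S where "char_graph S" "R \<subseteq> S" "(x, w) \<in> S" "Domain S = span1 (Domain R) x"
proof
  define S where "S = {(h + zmul k x, z * w powi k) | h k z. (h, z) \<in> R}"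
  have w0: "w \<noteq> 0" using w by auto
  have memI: "(h + zmul k x, z * w powi k) \<in> S" if "(h, z) \<in> R" for h k z
    using that unfolding S_def by blast
  show "R \<subseteq> S" using memI[of _ _ 0] by auto
  show "(x, w) \<in> S" using memI[OF char_graphD(1)[OF R], of 1] by simp
  show "Domain S = span1 (Domain R) x" unfolding S_def span1_def by blast
  show "char_graph S"
    unfolding char_graph_def
  proof (intro conjI allI impI ballI; clarify?)
    show "(0, 1) \<in> S" using \<open>R \<subseteq> S\<close> char_graphD(1)[OF R] by auto
    show "norm z = 1" if "(a, z) \<in> S" for a z
      using that w char_graphD(2)[OF R] by (auto simp: S_def norm_mult norm_power_int)
    show "(a - b, y / z) \<in> S" if ab: "(a, y) \<in> S" "(b, z) \<in> S" for a b y z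
    proof -
      obtain h k u g l v where eq: "a = h + zmul k x" "y = u * w powi k" "(h, u) \<in> R"
         "b = g + zmul l x" "z = v * w powi l" "(g, v) \<in> R" using ab unfolding S_def by blast
      have "a - b = (h - g) + zmul (k - l) x" "y / z = (u / v) * w powi (k - l)"
        using eq w0 by (auto simp: zmul_diff power_int_diff)
      then show ?thesis using memI[OF char_graphD(3)[OF R eq(3,6)]] by simp
    qed
    show "z = 1" if z: "(0, z) \<in> S" for z
    proof -
      obtain h k u where eq: "0 = h + zmul k x" "z = u * w powi k" "(h, u) \<in> R"
        using z by (auto simp: S_def)
      \<comment> \<open>The relation puts \<open>zmul k x\<close> into the domain of
        \<open>R\<close> with value \<open>1 / u\<close>, where \<open>comp\<close> applies.\<close>
      have "zmul k x = 0 - h" using eq(1) by (simp add: eq_neg_iff_add_eq_0 add.commute)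
      then have "(zmul k x, 1 / u) \<in> R" using char_graphD(3)[OF R char_graphD(1)[OF R] eq(3)] by simp
      then have "w powi k = 1 / u" using comp by simp
      then show ?thesis using eq(2) char_graphD(2)[OF R eq(3)] by auto
    qed
  qed
qed

lemma char_graph_zmul:
  assumes R: "char_graph R" and "(x, z) \<in> R" shows "(zmul k x, z powi k) \<in> R"
proof -
  have z0: "z \<noteq> 0" using char_graphD(2)[OF assms] by auto
  have step: "(a + x, y * z) \<in> R" if "(a, y) \<in> R" for a y
    using char_graphD(3)[OF R that char_graphD(3)[OF R char_graphD(1)[OF R] assms(2)]] by simp
  show ?thesis
  proof (induction k rule: int_induct[where k = 0])
    case base
    then show ?case using char_graphD(1)[OF R] by simp
  next
    case (step1 i)
    then show ?case using step z0 by (simp add: zmul_Suc power_int_add)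
  next
    case (step2 i)
    then show ?case using char_graphD(3)[OF R step2(2) assms(2)] z0
      by (simp add: zmul_diff power_int_diff)
  qed
qed

text \<open>Division with remainder: \<open>k mod int q\<close> also gives a multiple of
  \<open>x\<close> in \<open>H\<close>, and it is smaller than \<open>q\<close>.\<close>

lemma least_multiple_dvd:
  assumes H: "subgrp H" and q: "q > 0" "zmul (int q) x \<in> H"
    and least: "\<And>k::nat. 0 < k \<Longrightarrow> k < q \<Longrightarrow> zmul (int k) x \<notin> H"
    and k: "zmul k x \<in> H"
  shows "int q dvd k"
proof (rule ccontr)
  assume "\<not> int q dvd k"
  then have "k mod int q \<noteq> 0" by (simp add: mod_eq_0_iff_dvd)
  then have r: "k mod int q > 0" "k mod int q < int q"
    using q(1) pos_mod_sign[of "int q" k] pos_mod_bound[of "int q" k]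
    by linarith+
  have "k mod int q = k - (k div int q) * int q" by (simp add: minus_div_mult_eq_mod)
  then have "zmul (k mod int q) x = zmul k x - zmul (k div int q) (zmul (int q) x)"
    by (simp only: zmul_diff zmul_zmul)
  then have "zmul (k mod int q) x \<in> H" using subgrp_diff[OF H k subgrp_zmul[OF H q(2)]] by simp
  moreover have "nat (k mod int q) < q" using r by linarith
  ultimately show False using least[of "nat (k mod int q)"] r by simp
qed

text \<open>All multiples of \<open>x\<close> in the domain are multiples of
  \<open>zmul (int q) x\<close>, so every \<open>q\<close>-th root of the value there is admissible
  at \<open>x\<close>. This free choice of the root is exploited in the torsion case.\<close>

lemma char_graph_extend_root:
  assumes R: "char_graph R" and q: "q > 0" "(zmul (int q) x, u) \<in> R"
    and least: "\<And>k::nat. 0 < k \<Longrightarrow> k < q \<Longrightarrow> zmul (int k) x \<notin> Domain R"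
    and w: "w ^ q = u"
  obtains S where "char_graph S" "R \<subseteq> S" "(x, w) \<in> S" "Domain S = span1 (Domain R) x"
proof (rule char_graph_extend[OF R])
  have "norm w ^ q = 1" using char_graphD(2)[OF R q(2)] w by (auto simp: norm_power)
  then show "norm w = 1" using q(1) using power_eq_1_iff[of "norm w" q] by simp
  show "z = w powi k" if z: "(zmul k x, z) \<in> R" for k z
  proof -
    have "int q dvd k"
      by (rule least_multiple_dvd[OF char_graph_subgrp[OF R] q(1) _ least]) (use q(2) z in auto)
    then obtain m where m: "k = int q * m" by auto
    have "(zmul k x, u powi m) \<in> R"
      using char_graph_zmul[OF R q(2), of m] by (simp add: zmul_zmul m mult.commute)
    then have "z = u powi m" using char_graph_unique[OF R z] by auto
    then show ?thesis using w m by (simp add: power_int_mult)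
  qed
qed (use that in auto)

lemma circle_root: "norm (u::complex) = 1 \<Longrightarrow> q > 0 \<Longrightarrow> \<exists>w. w ^ q = u"
proof -
  assume u: "norm u = 1" "q > (0::nat)"
  have "cis (Arg u / q) ^ q = u"
    using u cis_Arg[of u] by (force simp: Complex.DeMoivre sgn_eq)
  then show ?thesis by blast
qed

text \<open>The circle is divisible, so any graph can be extended by one more element; a maximal
  graph from Zorn's lemma is therefore total.\<close>

lemma char_graph_total:
  assumes R: "char_graph R"
  obtains \<psi> where "character \<psi>" "\<And>x z. (x, z) \<in> R \<Longrightarrow> \<psi> x = z"
proof -
  let ?A = "{S. char_graph S \<and> R \<subseteq> S}"
  have "\<exists>M\<in>?A. \<forall>X\<in>?A. M \<subseteq> X \<longrightarrow> X = M"
  proof (rule subset_Zorn_nonempty)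
    show "?A \<noteq> {}" using R by auto
    fix C assume C: "C \<noteq> {}" "subset.chain ?A C"
    then have "char_graph (\<Union>C)"
      by (intro char_graph_Union) (auto simp: subset.chain_def)
    moreover have "R \<subseteq> \<Union>C" using C by (fastforce simp: subset.chain_def)
    ultimately show "\<Union>C \<in> ?A" by auto
  qed
  then obtain M where M: "char_graph M" "R \<subseteq> M"
    and max: "\<And>X. char_graph X \<Longrightarrow> M \<subseteq> X \<Longrightarrow> X = M" by (auto; blast)
  have dom: "x \<in> Domain M" for x
  proof -
    have "\<exists>S. char_graph S \<and> M \<subseteq> S \<and> x \<in> Domain S"
    proof (cases "\<exists>k::nat. k > 0 \<and> zmul (int k) x \<in> Domain M")
      case True
      define q where "q = (LEAST k::nat. k > 0 \<and> zmul (int k) x \<in> Domain M)"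
      have q: "q > 0" "zmul (int q) x \<in> Domain M" using LeastI_ex[OF True] by (auto simp: q_def)
      have least: "zmul (int k) x \<notin> Domain M" if "0 < k" "k < q" for k
        using not_less_Least[of k "\<lambda>k. k > 0 \<and> zmul (int k) x \<in> Domain M"] that by (auto simp: q_def)
      obtain u where u: "(zmul (int q) x, u) \<in> M" using q by auto
      obtain w where w: "w ^ q = u" using circle_root[OF char_graphD(2)[OF M(1) u] q(1)] by auto
      obtain S where "char_graph S" "M \<subseteq> S" "(x, w) \<in> S"
        by (rule char_graph_extend_root[OF M(1) q(1) u least w])
      then show ?thesis by blast
    next
      case False
      \<comment> \<open>No nonzero multiple of \<open>x\<close> lies in the domain, so its value is
        unconstrained; 1 is chosen.\<close>
      have "z = 1 powi k" if z: "(zmul k x, z) \<in> M" for k z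
      proof (cases "k = 0")
        case True
        then show ?thesis using z char_graphD(4)[OF M(1)] by auto
      next
        case k: False
        have "zmul (- k) x \<in> Domain M"
          using subgrp_minus[OF char_graph_subgrp[OF M(1)]] z by (auto simp: zmul_minus)
        then have "zmul (int (nat \<bar>k\<bar>)) x \<in> Domain M" using z by (auto simp: abs_if)
        then show ?thesis using False k by (metis zero_less_nat_eq zero_less_abs_iff)
      qed
      then obtain S where "char_graph S" "M \<subseteq> S" "(x, 1) \<in> S"
        by (rule char_graph_extend[OF M(1) norm_one])
      then show ?thesis by blast
    qed
    then show ?thesis using max by auto
  qed
  define \<psi> where "\<psi> x = (THE z. (x, z) \<in> M)" for x
  have eq: "\<psi> x = z" if "(x, z) \<in> M" for x z
    unfolding \<psi>_def using that char_graph_unique[OF M(1)] by (intro the_equality) auto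
  have mem: "(x, \<psi> x) \<in> M" for x using dom[of x] eq by auto
  have "\<psi> (x + y) = \<psi> x * \<psi> y" for x y
  proof (rule eq)
    show "(x + y, \<psi> x * \<psi> y) \<in> M"
      using char_graphD(3)[OF M(1) mem[of x] char_graphD(3)[OF M(1) char_graphD(1)[OF M(1)] mem[of y]]]
      by simp
  qed
  then have "character \<psi>" using char_graphD(2)[OF M(1) mem] by (auto simp: character_def)
  then show ?thesis using that eq M(2) by blast
qed

section \<open>Roots of unity and characters separating points from subgroups\<close>

lemma cis_root_eq_1_iff:
  assumes "q > 0" shows "cis (2 * pi * of_int k / real q) = 1 \<longleftrightarrow> int q dvd k"
proof
  assume "cis (2 * pi * of_int k / real q) = 1"
  then have "cos (2 * pi * of_int k / real q) = 1" by (metis cis.simps(1) one_complex.simps(1))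
  then obtain n :: int where "2 * pi * of_int k / real q = of_int n * 2 * pi"
    by (auto simp: cos_one_2pi_int)
  then have "of_int k = of_int n * real q" using assms by (simp add: field_simps)
  then have "k = n * int q" by (metis of_int_eq_iff of_int_mult of_int_of_nat_eq)
  then show "int q dvd k" by simp
next
  assume "int q dvd k"
  then obtain m where "k = int q * m" by auto
  then have "2 * pi * of_int k / real q = 2 * pi * of_int m" using assms by simp
  then show "cis (2 * pi * of_int k / real q) = 1" by (simp only:) (rule cis_multiple_2pi, simp)
qed

text \<open>The value at \<open>x\<close> can be a primitive \<open>q\<close>-th root of unity if
  \<open>x\<close> has finite order \<open>q > 1\<close> modulo \<open>H\<close>, and -1 if no
  nonzero multiple lies in \<open>H\<close>. Both are compatible with the trivial character on
  \<open>H\<close>.\<close>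

lemma character_separating:
  assumes H: "subgrp H" and x: "x \<notin> H"
  obtains \<psi> where "character \<psi>" "\<And>h. h \<in> H \<Longrightarrow> \<psi> h = 1" "\<psi> x \<noteq> 1"
proof -
  have R: "char_graph (H \<times> {1})" using H by (rule char_graph_trivial)
  have "\<exists>w::complex. norm w = 1 \<and> w \<noteq> 1 \<and> (\<forall>k. zmul k x \<in> H \<longrightarrow> w powi k = 1)"
  proof (cases "\<exists>k::nat. k > 0 \<and> zmul (int k) x \<in> H")
    case True
    define q where "q = (LEAST k::nat. k > 0 \<and> zmul (int k) x \<in> H)"
    have q: "q > 0" "zmul (int q) x \<in> H" using LeastI_ex[OF True] by (auto simp: q_def)
    have least: "zmul (int k) x \<notin> H" if "0 < k" "k < q" for k
      using not_less_Least[of k "\<lambda>k. k > 0 \<and> zmul (int k) x \<in> H"] that by (auto simp: q_def)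
    have "q \<noteq> 1" using q x by auto
    then have q1: "q > 1" using q by auto
    let ?w = "cis (2 * pi / q)"
    have wq: "?w ^ q = 1" using q by (simp add: Complex.DeMoivre)
    have "?w \<noteq> 1"
      using cis_root_eq_1_iff[of q 1] q1 by simp
    moreover have "?w powi k = 1" if "zmul k x \<in> H" for k
    proof -
      have "int q dvd k" using least_multiple_dvd[OF H q least that] by auto
      then show ?thesis using wq by (auto simp: power_int_mult)
    qed
    ultimately show ?thesis by (intro exI[of _ ?w]) auto
  next
    case False
    have "k = 0" if "zmul k x \<in> H" for k
    proof (rule ccontr)
      assume "k \<noteq> 0"
      moreover have "zmul (int (nat \<bar>k\<bar>)) x \<in> H"
        using that subgrp_minus[OF H that] by (auto simp: abs_if zmul_minus)
      ultimately show False using False by (metis zero_less_nat_eq zero_less_abs_iff)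
    qed
    then have "\<forall>k. zmul k x \<in> H \<longrightarrow> (-1::complex) powi k = 1" by (metis power_int_0_right)
    then show ?thesis by (intro exI[of _ "-1"]) auto
  qed
  then obtain w :: complex where w: "norm w = 1" "w \<noteq> 1" "\<And>k. zmul k x \<in> H \<Longrightarrow> w powi k = 1" by blast
  obtain S where S: "char_graph S" "H \<times> {1} \<subseteq> S" "(x, w) \<in> S"
    by (rule char_graph_extend[OF R w(1), of x]) (use w(3) in auto)
  obtain \<psi> where "character \<psi>" "\<And>x z. (x, z) \<in> S \<Longrightarrow> \<psi> x = z"
    using char_graph_total[OF S(1)] by blast
  then show ?thesis using that S w(2) by blast
qed

subsection \<open>Topologies of uniform and pointwise convergence on a sequence of characters\<close>

lemma norm_power_minus_1_le:
  fixes z :: complex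
  assumes "norm z = 1" shows "norm (z ^ n - 1) \<le> n * norm (z - 1)"
  using norm_power_diff[of z 1 n] assms by simp

lemma Re_nonneg_if_close: "norm (z - 1) \<le> 1 \<Longrightarrow> Re z \<ge> 0"
  using abs_Re_le_cmod[of "z - 1"] by simp

text \<open>Factor \<open>z\<^sup>2 - 1\<close> as \<open>(z + 1) * (z - 1)\<close>; in the right
  half-plane the first factor has norm at least \<open>sqrt 2\<close>.\<close>

lemma circle_doubling:
  fixes z :: complex
  assumes "norm z = 1" "Re z \<ge> 0" shows "sqrt 2 * norm (z - 1) \<le> norm (z\<^sup>2 - 1)"
proof -
  have "(norm (z + 1))\<^sup>2 = 2 + 2 * Re z"
    using assms(1) unfolding cmod_power2 by (simp add: norm_complex_def power2_eq_square algebra_simps)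
  then have "(sqrt 2)\<^sup>2 \<le> (norm (z + 1))\<^sup>2" using assms(2) by simp
  then have "sqrt 2 \<le> norm (z + 1)" by (rule power2_le_imp_le) simp
  then have "sqrt 2 * norm (z - 1) \<le> norm (z + 1) * norm (z - 1)" by (simp add: mult_right_mono)
  also have "\<dots> = norm (z\<^sup>2 - 1)" by (simp add: power2_eq_square algebra_simps flip: norm_mult)
  finally show ?thesis .
qed

text \<open>Each squaring expands the distance to 1 by \<open>sqrt 2\<close>, and distances on the
  circle are at most 2. Half-plane conditions on the powers thus force \<open>z\<close> to be close
  to 1, which is how quasi-convex sets fit inside balls.\<close>

lemma circle_doubling_iter:
  fixes z :: complex
  assumes z: "norm z = 1" and "\<And>j. j < K \<Longrightarrow> Re (z ^ 2 ^ j) \<ge> 0"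
  shows "sqrt 2 ^ K * norm (z - 1) \<le> 2"
proof -
  have "sqrt 2 ^ K * norm (z - 1) \<le> norm (z ^ 2 ^ K - 1)" using assms(2)
  proof (induction K)
    case (Suc K)
    have "sqrt 2 ^ Suc K * norm (z - 1) \<le> sqrt 2 * norm (z ^ 2 ^ K - 1)"
      using Suc by simp
    also have "\<dots> \<le> norm ((z ^ 2 ^ K)\<^sup>2 - 1)"
      using Suc.prems z by (intro circle_doubling) (auto simp: norm_power)
    finally show ?case by (simp add: mult.commute flip: power_mult)
  qed simp
  also have "\<dots> \<le> norm (z ^ 2 ^ K) + norm (1::complex)" by (rule norm_triangle_ineq4)
  finally show ?thesis using z by (simp add: norm_power)
qed

lemma sqrt2_power_large: "\<exists>K. r < sqrt 2 ^ K"
  by (rule real_arch_pow) simp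

text \<open>If all these powers stayed in the right half-plane, the distance from \<open>z\<close>
  to 1 would be at most \<open>2 / sqrt 2 ^ K\<close> for every \<open>K\<close>.\<close>

lemma circle_escape:
  fixes z :: complex
  assumes "norm z = 1" "z \<noteq> 1" obtains j where "Re (z ^ 2 ^ j) < 0"
proof (rule ccontr)
  assume no: "\<not> thesis"
  have nonneg: "Re (z ^ 2 ^ j) \<ge> 0" for j using no that[of j] by linarith
  obtain K where K: "2 / norm (z - 1) < sqrt 2 ^ K" using sqrt2_power_large by blast
  have "sqrt 2 ^ K * norm (z - 1) \<le> 2"
    using nonneg by (intro circle_doubling_iter assms)
  then show False using K assms(2) by (simp add: field_simps)
qed

lemma character_1_le_2: "character \<phi> \<Longrightarrow> norm (\<phi> x - 1) \<le> 2"
  using norm_triangle_ineq4[of "\<phi> x" 1] by (simp add: character_norm)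

section \<open>Length functions and the topologies they define\<close>

locale character_sequence =
  fixes H :: "'a::ab_group_add set" and c :: "nat \<Rightarrow> 'a \<Rightarrow> complex"
  assumes subgrp_H: "subgrp H" and char_c: "\<And>n. character (c n)"
begin

text \<open>Off \<open>H\<close> the length is an arbitrary value above the maximum \<open>2\<close> on \<open>H\<close>; this makes \<open>H\<close> open.\<close>

definition len :: "(nat \<Rightarrow> real) \<Rightarrow> 'a \<Rightarrow> real" where
  "len a x = (if x \<in> H then SUP n. a n * norm (c n x - 1) else 3)"

definition len_topology :: "(nat \<Rightarrow> real) \<Rightarrow> 'a topology" where
  "len_topology a = Metric_space.mtopology UNIV (\<lambda>x y. len a (x - y))"

end

text \<open>Weights tending to 0 give the product topology on \<open>H\<close>, constant weights the
  uniform one, so one construction serves both.\<close>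

locale weighted_character_sequence = character_sequence +
  fixes a :: "nat \<Rightarrow> real"
  assumes a_pos: "\<And>n. 0 < a n" and a_le_1: "\<And>n. a n \<le> 1"
    and separating: "\<And>x. x \<in> H \<Longrightarrow> (\<And>n. c n x = 1) \<Longrightarrow> x = 0"
begin

lemma term_le_2: "a n * norm (c n x - 1) \<le> 2"
  using mult_mono[OF a_le_1 character_1_le_2[OF char_c[of n], of x], of n] by simp

lemma term_le_len: "x \<in> H \<Longrightarrow> a n * norm (c n x - 1) \<le> len a x"
  unfolding len_def using term_le_2 by (auto intro!: cSUP_upper bdd_aboveI2)

lemma len_le: "x \<in> H \<Longrightarrow> (\<And>n. a n * norm (c n x - 1) \<le> r) \<Longrightarrow> len a x \<le> r"
  unfolding len_def by (auto intro!: cSUP_least)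

lemma len_less_3: "len a x < 3 \<longleftrightarrow> x \<in> H"
proof (cases "x \<in> H")
  case True
  then have "len a x \<le> 2" using term_le_2 by (rule len_le)
  then show ?thesis using True by simp
qed (simp add: len_def)

lemma len_le_3: "len a x \<le> 3"
  using len_less_3[of x] by (cases "x \<in> H") (auto simp: len_def)

lemma len_nonneg: "0 \<le> len a x"
proof (cases "x \<in> H")
  case True
  have "0 \<le> a 0 * norm (c 0 x - 1)" using a_pos[of 0] by simp
  then show ?thesis using term_le_len[OF True, of 0] by linarith
qed (simp add: len_def)

lemma len_0 [simp]: "len a 0 = 0"
  using char_c by (simp add: len_def subgrp_0[OF subgrp_H] character_0)

lemma len_eq_0: "len a x = 0 \<Longrightarrow> x = 0"
proof -
  assume 0: "len a x = 0"
  then have x: "x \<in> H" using len_less_3[of x] by simp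
  have "c n x = 1" for n
    using term_le_len[OF x, of n] 0 a_pos[of n] by (simp add: mult_le_0_iff)
  then show ?thesis using separating x by blast
qed

lemma len_minus: "len a (- x) = len a x"
proof -
  have "- x \<in> H \<longleftrightarrow> x \<in> H"
    using subgrp_minus[OF subgrp_H, of x] subgrp_minus[OF subgrp_H, of "- x"] by auto
  then show ?thesis by (simp add: len_def character_minus_1[OF char_c])
qed

text \<open>Outside \<open>H\<close> the length has its maximal value 3, so a summand outside
  \<open>H\<close> already gives the bound.\<close>

lemma len_add: "len a (x + y) \<le> len a x + len a y"
proof (cases "x \<in> H \<and> y \<in> H")
  case True
  have "a n * norm (c n (x + y) - 1) \<le> len a x + len a y" for n
  proof -
    have "a n * norm (c n (x + y) - 1) \<le> a n * (norm (c n x - 1) + norm (c n y - 1))"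
      using character_add_1[OF char_c] a_pos[of n] by (simp add: mult_left_mono)
    also have "\<dots> \<le> len a x + len a y"
      using term_le_len[of x n] term_le_len[of y n] True by (simp add: distrib_left)
    finally show ?thesis .
  qed
  then show ?thesis using True subgrp_add[OF subgrp_H] by (intro len_le) auto
next
  case False
  then have "len a x = 3 \<or> len a y = 3" by (auto simp: len_def)
  then show ?thesis using len_le_3[of "x + y"] len_nonneg[of x] len_nonneg[of y] by linarith
qed

sublocale Metric_space UNIV "\<lambda>x y. len a (x - y)"
proof
  show "len a (x - y) = len a (y - x)" for x y using len_minus[of "x - y"] by simp
  show "len a (x - y) = 0 \<longleftrightarrow> x = y" for x y using len_eq_0[of "x - y"] by (auto simp: len_0)
  show "len a (x - z) \<le> len a (x - y) + len a (y - z)" for x y z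
    using len_add[of "x - y" "y - z"] by simp
qed (simp add: len_nonneg)

lemma topspace_len: "topspace (len_topology a) = UNIV"
  by (simp add: len_topology_def)

lemma openin_len:
  "openin (len_topology a) U \<longleftrightarrow> (\<forall>x\<in>U. \<exists>r>0. \<forall>y. len a (y - x) < r \<longrightarrow> y \<in> U)"
  unfolding len_topology_def openin_mtopology
  by (auto simp: mball_def subset_iff commute)

lemma openin_len_ball: "openin (len_topology a) {y. len a (y - x) < r}"
proof -
  have "{y. len a (y - x) < r} = mball x r" by (auto simp: mball_def commute)
  then show ?thesis by (simp add: len_topology_def)
qed

lemma group_topology_len: "group_topology (len_topology a)"
  unfolding group_topology_def
proof (intro conjI topspace_len)
  show "continuous_map (prod_topology (len_topology a) (len_topology a)) (len_topology a) (\<lambda>(x, y). x + y)"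
    unfolding len_topology_def continuous_map_to_metric
  proof (intro ballI allI impI; clarify)
    fix x y :: 'a and e :: real assume e: "e > 0"
    let ?U = "mball x (e / 2) \<times> mball y (e / 2)"
    have "u + v \<in> mball (x + y) e" if "u \<in> mball x (e / 2)" "v \<in> mball y (e / 2)" for u v
    proof -
      have "len a ((x + y) - (u + v)) \<le> len a (x - u) + len a (y - v)"
        using len_add[of "x - u" "y - v"] by (simp add: algebra_simps)
      then show ?thesis using that by (simp add: mball_def)
    qed
    then have "\<forall>p\<in>?U. (case p of (x, y) \<Rightarrow> x + y) \<in> mball (x + y) e"
      by (simp add: split_paired_all del: in_mball)
    moreover have "openin (prod_topology mtopology mtopology) ?U" "(x, y) \<in> ?U"
      using e by (auto simp: openin_prod_Times_iff len_0)
    ultimately show "\<exists>U. openin (prod_topology mtopology mtopology) U \<and> (x, y) \<in> U \<and>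
        (\<forall>p\<in>U. (case p of (x, y) \<Rightarrow> x + y) \<in> mball (x + y) e)" by blast
  qed
  show "continuous_map (len_topology a) (len_topology a) uminus"
    unfolding len_topology_def continuous_map_to_metric
  proof (intro ballI allI impI)
    fix x :: 'a and e :: real assume e: "e > 0"
    have "- u \<in> mball (- x) e" if "u \<in> mball x e" for u
      using that len_minus[of "x - u"] by (simp add: mball_def)
    then show "\<exists>U. openin mtopology U \<and> x \<in> U \<and> (\<forall>u\<in>U. - u \<in> mball (- x) e)"
      using e by (intro exI[of _ "mball x e"]) auto
  qed
qed

text \<open>The metric is translation invariant, so a homomorphism is continuous once it is
  continuous at 0.\<close>

lemma dual_group_len:
  "\<phi> \<in> dual_group (len_topology a) \<longleftrightarrow>
     character \<phi> \<and> (\<forall>e>0. \<exists>r>0. \<forall>x. len a x < r \<longrightarrow> norm (\<phi> x - 1) < e)"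
  (is "_ \<longleftrightarrow> _ \<and> ?cont")
proof
  assume "\<phi> \<in> dual_group (len_topology a)"
  then have cont: "continuous_map (len_topology a) (top_of_set circle) \<phi>"
    and hom: "\<And>x y. \<phi> (x + y) = \<phi> x * \<phi> y" by (auto simp: dual_group_def)
  have ch: "character \<phi>"
    using cont hom topspace_len
    by (auto simp: character_def continuous_map_in_subtopology circle_def)
  have "\<exists>r>0. \<forall>x. len a x < r \<longrightarrow> norm (\<phi> x - 1) < e" if e: "e > 0" for e
  proof -
    have "continuous_map (len_topology a) euclidean \<phi>"
      using cont by (simp add: continuous_map_in_subtopology)
    then have "openin (len_topology a) {x \<in> topspace (len_topology a). \<phi> x \<in> ball 1 e}"
      by (rule openin_continuous_map_preimage) simp
    moreover have "0 \<in> {x. \<phi> x \<in> ball 1 e}" using e ch by (simp add: character_0)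
    ultimately show ?thesis unfolding openin_len topspace_len
      by (fastforce simp: dist_norm norm_minus_commute)
  qed
  then show "character \<phi> \<and> ?cont" using ch by blast
next
  assume R: "character \<phi> \<and> ?cont"
  then have ch: "character \<phi>" by blast
  have "openin (len_topology a) {x \<in> topspace (len_topology a). \<phi> x \<in> U}" if U: "open U" for U
    unfolding openin_len topspace_len
  proof (intro ballI)
    fix x assume "x \<in> {x \<in> UNIV. \<phi> x \<in> U}"
    then obtain e where e: "e > 0" "ball (\<phi> x) e \<subseteq> U" using U by (auto simp: open_contains_ball)
    obtain r where r: "r > 0" "\<And>x. len a x < r \<Longrightarrow> norm (\<phi> x - 1) < e" using R e(1) by blast
    have "\<phi> y \<in> U" if "len a (y - x) < r" for y
    proof -
      have "norm (\<phi> y - \<phi> x) < e" using r(2)[OF that] by (simp add: character_diff_1[OF ch])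
      then have "\<phi> y \<in> ball (\<phi> x) e" by (simp add: dist_norm norm_minus_commute)
      then show ?thesis using e(2) by blast
    qed
    then show "\<exists>r>0. \<forall>y. len a (y - x) < r \<longrightarrow> y \<in> {x \<in> UNIV. \<phi> x \<in> U}" using r(1) by blast
  qed
  then have "continuous_map (len_topology a) euclidean \<phi>"
    by (simp add: continuous_map_def topspace_len)
  then show "\<phi> \<in> dual_group (len_topology a)"
    using ch by (auto simp: dual_group_def continuous_map_in_subtopology circle_def character_def)
qed

text \<open>\<open>H\<close> is the open ball of radius 3 about 0.\<close>

lemma character_trivial_on_H_in_dual:
  assumes "character \<phi>" "\<And>x. x \<in> H \<Longrightarrow> \<phi> x = 1" shows "\<phi> \<in> dual_group (len_topology a)"
  unfolding dual_group_len using assms by (auto intro!: exI[of _ 3] simp: len_less_3)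

lemma c_power_in_dual: "(\<lambda>x. c n x ^ m) \<in> dual_group (len_topology a)"
  unfolding dual_group_len
proof (intro conjI allI impI character_power char_c)
  fix e :: real assume e: "e > 0"
  \<comment> \<open>The bound 3 forces \<open>x\<close> into \<open>H\<close>; the other bound
    absorbs the weight and the factor \<open>m\<close> from the power.\<close>
  define r where "r = min 3 (e * a n / (m + 1))"
  have "norm (c n x ^ m - 1) < e" if x: "len a x < r" for x
  proof -
    have "x \<in> H" using x len_less_3 by (auto simp: r_def)
    then have "a n * norm (c n x - 1) < e * a n / (m + 1)"
      using term_le_len[of x n] x by (simp add: r_def)
    then have "a n * (norm (c n x - 1) * (m + 1)) < a n * e" by (simp add: field_simps)
    then have "norm (c n x - 1) * (m + 1) < e" using a_pos[of n]
      by (simp only: mult_less_cancel_left_pos)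
    moreover have "norm (c n x ^ m - 1) \<le> m * norm (c n x - 1)"
      by (rule norm_power_minus_1_le) (simp add: character_norm char_c)
    ultimately show ?thesis using norm_ge_zero[of "c n x - 1"] by (simp add: algebra_simps del: norm_ge_zero)
  qed
  moreover have "r > 0" using e a_pos[of n] by (simp add: r_def)
  ultimately show "\<exists>r>0. \<forall>x. len a x < r \<longrightarrow> norm (c n x ^ m - 1) < e" by blast
qed

text \<open>Between two balls fits a set \<open>M\<close> cut out of \<open>H\<close> by half-plane
  conditions on powers of coordinates. These powers are continuous characters and witness
  quasi-convexity inside \<open>H\<close>; outside \<open>H\<close> a power of a separating
  character does.\<close>

lemma locally_quasi_convex_len: "locally_quasi_convex (len_topology a)"
  unfolding locally_quasi_convex_def
proof (intro conjI group_topology_len)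
  show "Hausdorff_space (len_topology a)" unfolding len_topology_def by (rule Hausdorff_space_mtopology)
  show "neighbourhood_base_at 0 (quasi_convex (len_topology a)) (len_topology a)"
    unfolding neighbourhood_base_at_def
  proof (intro allI impI, elim conjE)
    fix W assume "openin (len_topology a) W" "0 \<in> W"
    then obtain r where r: "r > 0" "\<And>y. len a y < r \<Longrightarrow> y \<in> W" unfolding openin_len by fastforce
    \<comment> \<open>After \<open>K\<close> successful squarings the distance to 1 is below
      \<open>r / 2\<close>.\<close>
    obtain K where K: "2 / (r / 2) < sqrt 2 ^ K" using sqrt2_power_large by blast
    \<comment> \<open>A coordinate with \<open>2 * a n \<le> r / 2\<close> contributes at most
      \<open>r / 2\<close> anyway and gets no condition.\<close>
    define M where "M = {x \<in> H. \<forall>n j. 2 * a n > r / 2 \<and> j < K \<longrightarrow> Re (c n x ^ 2 ^ j) \<ge> 0}"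
    \<comment> \<open>Coordinates of weight above \<open>r / 4\<close> are then within
      \<open>1 / 2 ^ K\<close> of 1, so their powers up to exponent \<open>2 ^ K\<close> stay in the
      right half-plane.\<close>
    define s where "s = min 3 (r / 4 / 2 ^ K)"
    have "s > 0" using r(1) by (simp add: s_def)
    have "M \<subseteq> W"
    proof
      fix x assume x: "x \<in> M"
      have "a n * norm (c n x - 1) \<le> r / 2" for n
      proof (cases "2 * a n > r / 2")
        case True
        have "sqrt 2 ^ K * norm (c n x - 1) \<le> 2"
          using x True by (intro circle_doubling_iter) (auto simp: M_def character_norm char_c)
        also have "2 \<le> sqrt 2 ^ K * (r / 2)" using K r(1) by (simp add: field_simps)
        finally have "norm (c n x - 1) \<le> r / 2" by simp
        then show ?thesis
          using mult_mono[OF a_le_1[of n], of "norm (c n x - 1)" "r / 2"] by simp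
      next
        case False
        have "a n * norm (c n x - 1) \<le> a n * 2"
          using a_pos[of n] character_1_le_2[OF char_c] by (simp add: mult_left_mono)
        then show ?thesis using False by linarith
      qed
      then have "len a x \<le> r / 2" using x by (intro len_le) (auto simp: M_def)
      then show "x \<in> W" using r by simp
    qed
    moreover have "{y. len a (y - 0) < s} \<subseteq> M"
    proof
      fix x assume "x \<in> {y. len a (y - 0) < s}"
      then have x: "len a x < s" by simp
      then have xH: "x \<in> H" using len_less_3 by (auto simp: s_def)
      have "Re (c n x ^ 2 ^ j) \<ge> 0" if n: "2 * a n > r / 2" and j: "j < K" for n j
      proof (rule Re_nonneg_if_close)
        have "r / 4 * norm (c n x - 1) \<le> a n * norm (c n x - 1)"
          using n by (intro mult_right_mono) auto
        also have "\<dots> < r / 4 / 2 ^ K" using term_le_len[OF xH, of n] x by (simp add: s_def)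
        finally have "2 ^ K * norm (c n x - 1) < 1" using r(1) by (simp add: field_simps)
        moreover have "2 ^ j * norm (c n x - 1) \<le> 2 ^ K * norm (c n x - 1)"
          using j by (intro mult_right_mono power_increasing) auto
        moreover have "norm (c n x ^ 2 ^ j - 1) \<le> 2 ^ j * norm (c n x - 1)"
          using norm_power_minus_1_le[of "c n x" "2 ^ j"] by (simp add: character_norm char_c)
        ultimately show "norm (c n x ^ 2 ^ j - 1) \<le> 1" by linarith
      qed
      then show "x \<in> M" using xH by (auto simp: M_def)
    qed
    moreover have "quasi_convex (len_topology a) M"
      unfolding quasi_convex_def
    proof (intro allI impI)
      fix x assume x: "x \<notin> M"
      have "\<exists>\<phi>\<in>dual_group (len_topology a). (\<forall>y\<in>M. Re (\<phi> y) \<ge> 0) \<and> Re (\<phi> x) < 0"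
      proof (cases "x \<in> H")
        case True
        then obtain n j where "2 * a n > r / 2" "j < K" "Re (c n x ^ 2 ^ j) < 0"
          using x by (auto simp: M_def not_le)
        then show ?thesis
          by (intro bexI[OF _ c_power_in_dual[of n "2 ^ j"]]) (auto simp: M_def)
      next
        case False
        obtain \<psi> where \<psi>: "character \<psi>" "\<And>h. h \<in> H \<Longrightarrow> \<psi> h = 1" "\<psi> x \<noteq> 1"
          using character_separating[OF subgrp_H False] by blast
        obtain j where j: "Re (\<psi> x ^ 2 ^ j) < 0"
          using circle_escape[OF character_norm[OF \<psi>(1)] \<psi>(3)] .
        have "(\<lambda>x. \<psi> x ^ 2 ^ j) \<in> dual_group (len_topology a)"
          using \<psi> by (intro character_trivial_on_H_in_dual character_power) auto
        then show ?thesis using j \<psi>(2) by (intro bexI) (auto simp: M_def)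
      qed
      then obtain \<phi> where \<phi>: "\<phi> \<in> dual_group (len_topology a)" "\<forall>y\<in>M. Re (\<phi> y) \<ge> 0" "Re (\<phi> x) < 0"
        by blast
      then have "\<phi> y \<in> circle" for y by (simp add: dual_group_len character_norm circle_def)
      then have "\<phi> ` M \<subseteq> circle_plus" "\<phi> x \<notin> circle_plus" using \<phi>(2,3) by (auto simp: circle_plus_def)
      then show "\<exists>\<phi>\<in>dual_group (len_topology a). \<phi> ` M \<subseteq> circle_plus \<and> \<phi> x \<notin> circle_plus"
        using \<phi>(1) by blast
    qed
    moreover have "0 \<in> {y. len a (y - 0) < s}" using \<open>s > 0\<close> len_0 by simp
    ultimately show "\<exists>U V. openin (len_topology a) U \<and> quasi_convex (len_topology a) V \<and>
        0 \<in> U \<and> U \<subseteq> V \<and> V \<subseteq> W"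
      using openin_len_ball[of 0 s] by blast
  qed
qed

lemma metrizable_len: "metrizable_space (len_topology a)"
  unfolding len_topology_def by (rule metrizable_space_mtopology)

end

section \<open>Comparison of the product topology with the uniform topology\<close>

context character_sequence
begin

text \<open>Continuity at 0 on \<open>H\<close> for the supremum distance, phrased with non-strict
  bounds on single coordinates so that no supremum appears.\<close>

definition uniformly_continuous_char :: "('a \<Rightarrow> complex) \<Rightarrow> bool" where
  "uniformly_continuous_char \<phi> \<longleftrightarrow>
     (\<forall>d>0. \<exists>e>0. \<forall>x\<in>H. (\<forall>n. norm (c n x - 1) \<le> e) \<longrightarrow> norm (\<phi> x - 1) \<le> d)"

definition pointwise_continuous_char :: "('a \<Rightarrow> complex) \<Rightarrow> bool" where
  "pointwise_continuous_char \<phi> \<longleftrightarrow>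
     (\<forall>d>0. \<exists>N. \<exists>e>0. \<forall>x\<in>H. (\<forall>n<N. norm (c n x - 1) \<le> e) \<longrightarrow> norm (\<phi> x - 1) \<le> d)"

text \<open>Weights \<open>1 / (n + 1)\<close> give the product topology and weights 1 the uniform
  one. By \<open>compat\<close> they have the same dual, and by \<open>finer\<close> the uniform
  ball of radius \<open>k\<close> is not open in the product topology.\<close>

lemma metrizable_not_Mackey:
  assumes separating: "\<And>x. x \<in> H \<Longrightarrow> (\<And>n. c n x = 1) \<Longrightarrow> x = 0"
    and compat: "\<And>\<phi>. character \<phi> \<Longrightarrow> uniformly_continuous_char \<phi> \<Longrightarrow> pointwise_continuous_char \<phi>"
    and finer: "k > 0" "\<And>N e. e > 0 \<Longrightarrow> \<exists>x\<in>H. (\<forall>n<N. norm (c n x - 1) \<le> e) \<and> (\<exists>n. norm (c n x - 1) \<ge> k)"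
  shows "\<exists>\<tau> :: 'a topology. metrizable_space \<tau> \<and> locally_quasi_convex \<tau> \<and> \<not> Mackey \<tau>"
proof -
  define a where "a n = 1 / (real n + 1)" for n
  define b :: "nat \<Rightarrow> real" where "b n = 1" for n
  interpret A: weighted_character_sequence H c a
    by unfold_locales (auto simp: a_def separating)
  interpret B: weighted_character_sequence H c b
    by unfold_locales (auto simp: b_def separating)
  have "dual_group (len_topology a) = dual_group (len_topology b)"
  proof (intro equalityI subsetI)
    fix \<phi> assume \<phi>: "\<phi> \<in> dual_group (len_topology a)"
    have "len a x \<le> len b x" for x
    proof (cases "x \<in> H")
      case True
      have "a n * norm (c n x - 1) \<le> len b x" for n
        using B.term_le_len[OF True, of n] mult_right_mono[OF A.a_le_1[of n], of "norm (c n x - 1)"]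
        by (simp add: b_def)
      then show ?thesis using True by (intro A.len_le)
    qed (simp add: len_def)
    then show "\<phi> \<in> dual_group (len_topology b)"
      using \<phi> unfolding A.dual_group_len B.dual_group_len by (meson le_less_trans)
  next
    fix \<phi> assume \<phi>: "\<phi> \<in> dual_group (len_topology b)"
    then have ch: "character \<phi>" by (simp add: B.dual_group_len)
    have "uniformly_continuous_char \<phi>" unfolding uniformly_continuous_char_def
    proof (intro allI impI)
      fix d :: real assume "d > 0"
      then obtain r where r: "r > 0" "\<And>x. len b x < r \<Longrightarrow> norm (\<phi> x - 1) < d"
        using \<phi> by (auto simp: B.dual_group_len)
      have "norm (\<phi> x - 1) \<le> d" if "x \<in> H" "\<forall>n. norm (c n x - 1) \<le> r / 2" for x
      proof -
        have "len b x \<le> r / 2" using that by (intro B.len_le) (auto simp: b_def)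
        then show ?thesis using r(1) r(2)[of x] by simp
      qed
      then show "\<exists>e>0. \<forall>x\<in>H. (\<forall>n. norm (c n x - 1) \<le> e) \<longrightarrow> norm (\<phi> x - 1) \<le> d"
        using r(1) by (intro exI[of _ "r / 2"]) auto
    qed
    then have pc: "pointwise_continuous_char \<phi>" using compat ch by blast
    show "\<phi> \<in> dual_group (len_topology a)"
      unfolding A.dual_group_len
    proof (intro conjI allI impI ch)
      fix d :: real assume "d > 0"
      then obtain N e where e: "e > 0"
        "\<And>x. x \<in> H \<Longrightarrow> (\<And>n. n < N \<Longrightarrow> norm (c n x - 1) \<le> e) \<Longrightarrow> norm (\<phi> x - 1) \<le> d / 2"
        using pc unfolding pointwise_continuous_char_def by (metis half_gt_zero)
      \<comment> \<open>The bound 3 forces \<open>x\<close> into \<open>H\<close>. The first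
        \<open>N\<close> weights are at least \<open>1 / (N + 1)\<close>, so the unweighted
        distances are at most \<open>e\<close>.\<close>
      define r where "r = min 3 (e / (real N + 1))"
      have "norm (\<phi> x - 1) < d" if x: "len a x < r" for x
      proof -
        have xH: "x \<in> H" using x A.len_less_3 by (auto simp: r_def)
        have "norm (c n x - 1) \<le> e" if n: "n < N" for n
        proof -
          have "norm (c n x - 1) / (real n + 1) \<le> e / (real N + 1)"
            using A.term_le_len[OF xH, of n] x by (simp add: r_def a_def)
          then have "norm (c n x - 1) \<le> e / (real N + 1) * (real n + 1)"
            by (simp add: field_simps)
          also have "\<dots> \<le> e / (real N + 1) * (real N + 1)"
            using n e(1) by (intro mult_left_mono) auto
          finally show ?thesis by simp
        qed
        then show ?thesis using e(2)[OF xH] \<open>d > 0\<close> by force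
      qed
      moreover have "r > 0" using e(1) by (simp add: r_def)
      ultimately show "\<exists>r>0. \<forall>x. len a x < r \<longrightarrow> norm (\<phi> x - 1) < d" by blast
    qed
  qed
  moreover have "\<not> openin (len_topology a) {y. len b (y - 0) < k}"
  proof
    assume "openin (len_topology a) {y. len b (y - 0) < k}"
    moreover have "0 \<in> {y. len b (y - 0) < k}" using finer(1) B.len_0 by simp
    ultimately have "\<exists>r>0. \<forall>y. len a (y - 0) < r \<longrightarrow> y \<in> {y. len b (y - 0) < k}"
      unfolding A.openin_len by (rule bspec)
    then obtain r where r: "r > 0" "\<And>y. len a y < r \<Longrightarrow> len b y < k" by auto
    \<comment> \<open>Coordinates from \<open>N\<close> on contribute at most \<open>r / 2\<close>,
      since their weight is below \<open>1 / N\<close> and distances are at most 2.\<close>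
    obtain N :: nat where N: "4 / r < real N" using reals_Archimedean2 by blast
    obtain x where x: "x \<in> H" "\<And>n. n < N \<Longrightarrow> norm (c n x - 1) \<le> r / 2" "\<exists>n. norm (c n x - 1) \<ge> k"
      using finer(2)[of "r / 2" N] r(1) by auto
    have "a n * norm (c n x - 1) \<le> r / 2" for n
    proof (cases "n < N")
      case True
      then show ?thesis
        using x(2) mult_mono[OF A.a_le_1[of n] x(2), of n] by simp
    next
      case False
      have "a n * norm (c n x - 1) \<le> a n * 2"
        using A.a_pos[of n] character_1_le_2[OF char_c] by (simp add: mult_left_mono)
      also have "\<dots> \<le> r / 2"
      proof -
        have "4 < r * real N" using N r(1) by (simp add: field_simps)
        also have "\<dots> \<le> r * real n" using False r(1) by simp
        finally show ?thesis using r(1) by (simp add: a_def field_simps)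
      qed
      finally show ?thesis .
    qed
    then have "len a x \<le> r / 2" using x(1) by (intro A.len_le)
    then have "len b x < k" using r by simp
    moreover obtain n where "norm (c n x - 1) \<ge> k" using x(3) by blast
    ultimately show False using B.term_le_len[OF x(1), of n] by (simp add: b_def)
  qed
  ultimately have "\<not> Mackey (len_topology a)"
    using B.locally_quasi_convex_len B.openin_len_ball[of 0 k]
    unfolding Mackey_def compatible_def by metis
  then show ?thesis using A.metrizable_len A.locally_quasi_convex_len by blast
qed

end

subsection \<open>Characters continuous in the uniform topology\<close>

lemma norm_cis_minus_1: "norm (cis t - 1) \<le> \<bar>t\<bar>"
  using dist_exp_i_1[of t] abs_sin_x_le_abs_x[of "t / 2"] by (simp add: cis_conv_exp)

lemma norm_cis_diff: "norm (cis s - cis t) \<le> \<bar>s - t\<bar>"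
proof -
  have "cis s - cis t = cis t * (cis (s - t) - 1)" by (simp add: algebra_simps cis_mult)
  then show ?thesis using norm_cis_minus_1[of "s - t"] by (simp add: norm_mult)
qed

lemma circle_cis_Arg: "norm z = 1 \<Longrightarrow> cis (Arg z) = z"
  using cis_Arg[of z] by (force simp: sgn_eq)

lemma cos_nonneg_imp_le_pi_half:
  assumes "0 \<le> cos t" "0 \<le> t" "t \<le> pi" shows "t \<le> pi / 2"
  using cos_monotone_0_pi[of "pi / 2" t] assms by (force simp: not_le)

text \<open>\<open>z ^ q - 1\<close> is \<open>z - 1\<close> times a geometric sum, all of whose
  \<open>q\<close> terms have real part at least \<open>1 / 2\<close>.\<close>

lemma power_minus_1_growth:
  fixes z :: complex
  assumes "\<And>r. r < q \<Longrightarrow> norm (z ^ r - 1) \<le> 1 / 2"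
  shows "q / 2 * norm (z - 1) \<le> norm (z ^ q - 1)"
proof -
  have "1 / 2 \<le> Re (z ^ r)" if "r < q" for r
    using abs_Re_le_cmod[of "z ^ r - 1"] assms[OF that] by simp
  then have "(\<Sum>r<q. 1 / 2) \<le> (\<Sum>r<q. Re (z ^ r))" by (intro sum_mono) auto
  also have "\<dots> = Re (\<Sum>r<q. z ^ r)" by simp
  also have "\<dots> \<le> norm (\<Sum>r<q. z ^ r)" by (rule complex_Re_le_cmod)
  finally have "q / 2 * norm (z - 1) \<le> norm (\<Sum>r<q. z ^ r) * norm (z - 1)"
    by (intro mult_right_mono) auto
  also have "\<dots> = norm (z ^ q - 1)" by (simp add: power_diff_1_eq norm_mult mult.commute)
  finally show ?thesis .
qed

context character_sequence
begin

text \<open>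
  On a small uniform ball a uniformly continuous \<open>\<phi>\<close> is pointwise continuous: otherwise one adds
  up many elements on which \<open>\<phi>\<close> has argument at least \<open>d\<close> and whose coordinates are essentially
  disjointly supported, so that the sum stays small while its argument leaves \<open>[0, pi / 2]\<close>.
\<close>

lemma pointwise_continuous_on_ball:
  assumes null: "\<And>x. x \<in> H \<Longrightarrow> (\<lambda>n. c n x) \<longlonglongrightarrow> 1"
    and ch: "character \<phi>" and uc: "uniformly_continuous_char \<phi>"
  obtains e0 where "e0 > 0" "\<And>d. d > 0 \<Longrightarrow> \<exists>N. \<exists>e>0. \<forall>y\<in>H. (\<forall>n. norm (c n y - 1) \<le> e0) \<longrightarrow>
    (\<forall>n<N. norm (c n y - 1) \<le> e) \<longrightarrow> norm (\<phi> y - 1) \<le> d"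
proof -
  obtain e1 where e1: "e1 > 0"
    "\<And>x. x \<in> H \<Longrightarrow> (\<And>n. norm (c n x - 1) \<le> e1) \<Longrightarrow> norm (\<phi> x - 1) \<le> 1"
    using uc unfolding uniformly_continuous_char_def by (metis zero_less_one)
  have Re_nonneg: "Re (\<phi> x) \<ge> 0" if "x \<in> H" "\<And>n. norm (c n x - 1) \<le> e1" for x
    using Re_nonneg_if_close e1(2)[OF that] by blast
  \<comment> \<open>Half of \<open>e1\<close>: sums that are within \<open>2 * e0\<close> of 1 in
    every coordinate still have \<open>\<phi>\<close>-value in the right half-plane.\<close>
  define e0 where "e0 = e1 / 2"
  have e0: "e0 > 0" using e1(1) by (simp add: e0_def)
  have "\<exists>N. \<exists>e>0. \<forall>y\<in>H. (\<forall>n. norm (c n y - 1) \<le> e0) \<longrightarrow>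
    (\<forall>n<N. norm (c n y - 1) \<le> e) \<longrightarrow> norm (\<phi> y - 1) \<le> d" if d: "d > 0" for d
  proof (rule ccontr)
    assume "\<not> ?thesis"
    then have bad: "\<exists>y\<in>H. (\<forall>n. norm (c n y - 1) \<le> e0) \<and> (\<forall>n<N. norm (c n y - 1) \<le> e) \<and>
        norm (\<phi> y - 1) > d" if "e > 0" for N e
      using that by (metis not_le)
    have arg_bad: "\<exists>y\<in>H. \<exists>t. \<phi> y = cis t \<and> d \<le> t \<and> t \<le> pi / 2 \<and>
        (\<forall>n. norm (c n y - 1) \<le> e0) \<and> (\<forall>n<N. norm (c n y - 1) \<le> e)" if e: "e > 0" for N e
    proof -
      obtain y where y: "y \<in> H" "\<And>n. norm (c n y - 1) \<le> e0" "\<And>n. n < N \<Longrightarrow> norm (c n y - 1) \<le> e"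
        "norm (\<phi> y - 1) > d" using bad[OF e, of N] by blast
      \<comment> \<open>Passing to \<open>- y\<close> if necessary makes the argument of
        \<open>\<phi>\<close> positive, so that arguments add up without cancelling.\<close>
      define y' where "y' = (if Arg (\<phi> y) \<ge> 0 then y else - y)"
      define t where "t = \<bar>Arg (\<phi> y)\<bar>"
      have arg: "cis (Arg (\<phi> y)) = \<phi> y" by (rule circle_cis_Arg) (simp add: character_norm ch)
      have "d \<le> t" using norm_cis_minus_1[of "Arg (\<phi> y)"] y(4) arg by (simp add: t_def)
      moreover have "\<phi> y' = cis t"
        using arg cis_inverse[of "Arg (\<phi> y)"] by (simp add: y'_def t_def character_minus[OF ch])
      moreover have y': "norm (c n y' - 1) = norm (c n y - 1)" for n
        by (simp add: y'_def character_minus_1[OF char_c])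
      moreover have "y' \<in> H" using y(1) subgrp_minus[OF subgrp_H] by (simp add: y'_def)
      moreover have "t \<le> pi / 2"
      proof (rule cos_nonneg_imp_le_pi_half)
        have "norm (c n y - 1) \<le> e1" for n using y(2)[of n] e1(1) by (simp add: e0_def)
        then have "0 \<le> Re (\<phi> y)" by (rule Re_nonneg[OF y(1)])
        also have "Re (\<phi> y) = cos (Arg (\<phi> y))" by (metis arg cis.simps(1))
        finally show "0 \<le> cos t" by (simp add: t_def)
        show "t \<le> pi" using Arg_bounded[of "\<phi> y"] unfolding t_def by linarith
      qed (simp add: t_def)
      ultimately show ?thesis using y(2,3) by metis
    qed
    \<comment> \<open>The slack \<open>e\<close> above \<open>e0\<close> is arbitrary and does not
      grow with the number \<open>m\<close> of summands.\<close>
    have sum_bad: "\<exists>y\<in>H. \<exists>t. \<phi> y = cis t \<and> real m * d \<le> t \<and> t \<le> pi / 2 \<and>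
        (\<forall>n. norm (c n y - 1) \<le> e0 + e) \<and> (\<forall>n<N. norm (c n y - 1) \<le> e)" if "e > 0" for m N e
      using that
    proof (induction m arbitrary: N e)
      case 0
      then show ?case
        using e0 by (intro bexI[of _ 0] exI[of _ 0])
          (auto simp: character_0 ch char_c subgrp_0[OF subgrp_H])
    next
      case (Suc m)
      define f where "f = min e e0"
      have f: "f > 0" "f \<le> e" "f \<le> e0" using Suc.prems e0 by (auto simp: f_def)
      obtain y t where y: "y \<in> H" "\<phi> y = cis t" "m * d \<le> t" "t \<le> pi / 2"
        "\<And>n. norm (c n y - 1) \<le> e0 + f / 2" "\<And>n. n < N \<Longrightarrow> norm (c n y - 1) \<le> f / 2"
        using Suc.IH[of "f / 2" N] f(1) by auto
      \<comment> \<open>Coordinates of \<open>y\<close> are negligible from \<open>N'\<close> on,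
        and \<open>z\<close> is chosen negligible before \<open>N'\<close>, so at each coordinate at
        most one of the two is large.\<close>
      obtain N' where N': "\<And>n. n \<ge> N' \<Longrightarrow> norm (c n y - 1) < f / 2"
        using LIMSEQ_D[OF null[OF y(1)], of "f / 2"] f(1) by auto
      obtain z s where z: "z \<in> H" "\<phi> z = cis s" "d \<le> s" "s \<le> pi / 2"
        "\<And>n. norm (c n z - 1) \<le> e0" "\<And>n. n < max N N' \<Longrightarrow> norm (c n z - 1) \<le> f / 2"
        using arg_bad[of "f / 2" "max N N'"] f(1) by auto
      have yz: "y + z \<in> H" using y(1) z(1) by (rule subgrp_add[OF subgrp_H])
      have phi: "\<phi> (y + z) = cis (t + s)" using y(2) z(2) by (simp add: character_add[OF ch] cis_mult)
      have small: "norm (c n (y + z) - 1) \<le> e0 + f" for n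
      proof (cases "n < N'")
        case True
        then show ?thesis
          using character_add_1[OF char_c, of n y z] y(5)[of n] z(6)[of n]
          by (simp add: less_max_iff_disj)
      next
        case False
        then show ?thesis
          using character_add_1[OF char_c, of n y z] z(5)[of n] N'[of n] f(1) by simp
      qed
      have "norm (c n (y + z) - 1) \<le> f" if "n < N" for n
        using character_add_1[OF char_c, of n y z] y(6)[of n] z(6)[of n] that
        by (simp add: less_max_iff_disj)
      \<comment> \<open>A priori \<open>t + s\<close> is only at most \<open>pi\<close>; the sign of
        the cosine improves this, so the argument never wraps around.\<close>
      moreover have "t + s \<le> pi / 2"
      proof (rule cos_nonneg_imp_le_pi_half)
        have "norm (c n (y + z) - 1) \<le> e1" for n using small[of n] f(3) by (simp add: e0_def)
        then have "Re (\<phi> (y + z)) \<ge> 0" using yz by (intro Re_nonneg)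
        then show "0 \<le> cos (t + s)" by (simp add: phi)
        have "0 \<le> real m * d" using d by simp
        then show "0 \<le> t + s" using y(3) z(3) d by linarith
      qed (use y(4) z(4) in simp)
      moreover have "real (Suc m) * d \<le> t + s" using y(3) z(3) by (simp add: algebra_simps)
      moreover have "norm (c n (y + z) - 1) \<le> e0 + e" for n using small[of n] f(2) by linarith
      ultimately show ?case using yz phi f(2) by (meson order_trans)
    qed
    obtain m :: nat where m: "pi < real m * d" using reals_Archimedean3[OF d] by blast
    obtain t where "real m * d \<le> t" "t \<le> pi / 2" using sum_bad[of 1 m 0] by auto
    then show False using m pi_gt_zero by linarith
  qed
  then show ?thesis using that e0 by blast
qed

end

subsection \<open>Groups with an element of infinite order\<close>

text \<open>For compatibility, follow \<open>w n = \<phi> (zmul (int (fact n)) x)\<close>. For large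
  \<open>n\<close> it is so close to 1 that raising it to the power \<open>n + 1\<close>, which
  gives \<open>w (Suc n)\<close>, at least doubles the distance to 1. Distances are bounded, so
  \<open>w n0 = 1\<close> for some \<open>n0\<close>, and \<open>\<phi>\<close> is trivial on a
  product-open subgroup.\<close>

lemma infinite_order_not_Mackey:
  fixes x :: "'a::ab_group_add"
  assumes inf: "\<And>k. zmul k x = 0 \<Longrightarrow> k = 0"
  shows "\<exists>\<tau> :: 'a topology. metrizable_space \<tau> \<and> locally_quasi_convex \<tau> \<and> \<not> Mackey \<tau>"
proof -
  have "\<exists>\<psi>. character \<psi> \<and> \<psi> x = cis (2 * pi / fact n)" for n
  proof -
    have R: "char_graph ({0::'a} \<times> {1})" by (rule char_graph_trivial) (simp add: subgrp_def)
    have "z = cis (2 * pi / fact n) powi k" if "(zmul k x, z) \<in> {0} \<times> {1}" for k z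
      using that inf[of k] by auto
    then obtain S where "char_graph S" "(x, cis (2 * pi / fact n)) \<in> S"
      using char_graph_extend[OF R norm_cis] by metis
    then show ?thesis using char_graph_total by metis
  qed
  then obtain c where char_c: "\<And>n. character (c n)" and c_x: "\<And>n. c n x = cis (2 * pi / fact n)"
    by metis
  define H where "H = range (\<lambda>k. zmul k x)"
  have "subgrp H"
    unfolding subgrp_def H_def by (auto simp flip: zmul_diff intro!: range_eqI[of _ _ 0])
  then interpret character_sequence H c using char_c by unfold_locales
  have c_zmul: "c n (zmul k x) = cis (2 * pi * of_int k / fact n)" for n k
    by (simp add: character_zmul[OF char_c] c_x cis_power_int mult_ac)
  have c_eq_1: "c n (zmul k x) = 1 \<longleftrightarrow> int (fact n) dvd k" for n k
    using cis_root_eq_1_iff[of "fact n" k] by (simp add: c_zmul)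
  have c_fact: "c j (zmul (int (r * fact n)) x) = 1" if "j \<le> n" for j n r
    unfolding c_eq_1 int_dvd_int_iff by (rule dvd_mult[OF fact_dvd[OF that]])
  show ?thesis
  proof (rule metrizable_not_Mackey)
    show "y = 0" if y: "y \<in> H" "\<And>n. c n y = 1" for y
    proof -
      obtain k where k: "y = zmul k x" using y(1) by (auto simp: H_def)
      \<comment> \<open>Then \<open>fact n\<close> exceeds \<open>\<bar>k\<bar>\<close>, so it
        divides \<open>k\<close> only if \<open>k = 0\<close>.\<close>
      define n where "n = Suc (nat \<bar>k\<bar>)"
      have "int (fact n) dvd k" using y(2)[of n] c_eq_1 k by simp
      moreover have "\<bar>k\<bar> < int (fact n)"
      proof -
        have "\<bar>k\<bar> < int n" by (simp add: n_def)
        also have "int n \<le> int (fact n)" using fact_ge_self[of n] by (simp only: of_nat_le_iff)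
        finally show ?thesis .
      qed
      ultimately have "k = 0" using dvd_imp_le_int[of k "int (fact n)"] by force
      then show ?thesis using k by simp
    qed
    show "\<exists>y\<in>H. (\<forall>n<N. norm (c n y - 1) \<le> e) \<and> (\<exists>n. norm (c n y - 1) \<ge> 2)" if "e > 0" for N e
    proof (intro bexI conjI exI)
      \<comment> \<open>The multiplier is half of \<open>fact (2 * N + 2)\<close>: coordinates up to
        \<open>2 * N + 1\<close> are 1 and the next one is -1.\<close>
      let ?y = "zmul (int ((N + 1) * fact (2 * N + 1))) x"
      show "?y \<in> H" by (simp add: H_def)
      show "\<forall>n<N. norm (c n ?y - 1) \<le> e" using c_fact[of _ "2 * N + 1" "N + 1"] that by simp
      define z :: real where "z = (real N + 1) * fact (2 * N + 1)"
      have "z > 0" by (simp add: z_def)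
      moreover have "fact (Suc (2 * N + 1)) = 2 * z"
        unfolding fact_Suc[of "2 * N + 1"] z_def by (simp del: fact_Suc)
      moreover have "of_int (int ((N + 1) * fact (2 * N + 1))) = z"
        by (simp add: z_def distrib_right del: fact_Suc)
      ultimately have "2 * pi * of_int (int ((N + 1) * fact (2 * N + 1))) / fact (Suc (2 * N + 1)) = pi"
        by simp
      then have "c (Suc (2 * N + 1)) ?y = -1" by (simp only: c_zmul cis_pi)
      then show "norm (c (Suc (2 * N + 1)) ?y - 1) \<ge> 2" by simp
    qed
    show "pointwise_continuous_char \<phi>" if ch: "character \<phi>" and uc: "uniformly_continuous_char \<phi>" for \<phi>
    proof -
      have null: "(\<lambda>n. c n y) \<longlonglongrightarrow> 1" if y: "y \<in> H" for y
      proof -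
        obtain k where k: "y = zmul k x" using y by (auto simp: H_def)
        have bound: "norm (c n y - 1) \<le> (2 * pi * \<bar>of_int k\<bar>) / of_nat n" if "n > 0" for n
        proof -
          have "real n \<le> fact n" using fact_ge_self[of n] by (metis of_nat_fact of_nat_le_iff)
          then have "2 * pi * \<bar>of_int k\<bar> / fact n \<le> 2 * pi * \<bar>of_int k\<bar> / real n"
            using that by (intro divide_left_mono) auto
          then show ?thesis
            using norm_cis_minus_1[of "2 * pi * of_int k / fact n"] k by (simp add: c_zmul abs_mult)
        qed
        have "(\<lambda>n. c n y - 1) \<longlonglongrightarrow> 0"
        proof (rule Lim_null_comparison)
          show "\<forall>\<^sub>F n in sequentially. norm (c n y - 1) \<le> (2 * pi * \<bar>of_int k\<bar>) / of_nat n"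
            using eventually_gt_at_top[of 0] by eventually_elim (rule bound)
          show "(\<lambda>n. (2 * pi * \<bar>of_int k\<bar>) / of_nat n :: real) \<longlonglongrightarrow> 0"
            by (rule lim_const_over_n)
        qed
        then show ?thesis by (simp add: LIM_zero_iff)
      qed
      obtain e0 where e0: "e0 > 0" "\<And>d. d > 0 \<Longrightarrow> \<exists>N. \<exists>e>0. \<forall>y\<in>H. (\<forall>n. norm (c n y - 1) \<le> e0) \<longrightarrow>
          (\<forall>n<N. norm (c n y - 1) \<le> e) \<longrightarrow> norm (\<phi> y - 1) \<le> d"
        using pointwise_continuous_on_ball[OF null ch uc] by metis
      \<comment> \<open>For \<open>r \<le> \<rho> * (n + 1)\<close> the element
        \<open>zmul (int (r * fact n)) x\<close> has coordinates 1 up to \<open>n\<close> and within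
        \<open>2 * pi * \<rho> \<le> e0\<close> of 1 afterwards.\<close>
      define \<rho> where "\<rho> = min 1 (e0 / (2 * pi))"
      have \<rho>: "0 < \<rho>" "\<rho> \<le> 1" "2 * pi * \<rho> \<le> e0"
        using e0(1) by (auto simp: \<rho>_def min_def field_simps)
      define w where "w n = \<phi> (zmul (int (fact n)) x)" for n
      have w_Suc: "w (Suc n) = w n ^ Suc n" for n
      proof -
        have "zmul (int (fact (Suc n))) x = zmul (int (Suc n)) (zmul (int (fact n)) x)"
          by (simp add: zmul_zmul distrib_right)
        then show ?thesis unfolding w_def by (simp only: character_zmul[OF ch] power_int_of_nat)
      qed
      have norm_w: "norm (w n) = 1" for n by (simp add: w_def character_norm ch)
      \<comment> \<open>The tolerance \<open>\<rho> / 8\<close> is what yields the bound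
        \<open>1 / 2\<close> in \<open>w_small\<close>.\<close>
      have "\<rho> / 8 > 0" using \<rho>(1) by simp
      from e0(2)[OF this] obtain N e where N: "e > 0" "\<And>y. y \<in> H \<Longrightarrow> (\<And>n. norm (c n y - 1) \<le> e0) \<Longrightarrow>
          (\<And>n. n < N \<Longrightarrow> norm (c n y - 1) \<le> e) \<Longrightarrow> norm (\<phi> y - 1) \<le> \<rho> / 8"
        by blast
      have w_power: "norm (w n ^ r - 1) \<le> \<rho> / 8" if n: "n \<ge> N" and r: "real r \<le> \<rho> * real (n + 1)" for n r
      proof -
        let ?y = "zmul (int (r * fact n)) x"
        have "norm (c j ?y - 1) \<le> e0" for j
        proof (cases "j \<le> n")
          case False
          have "fact (Suc n) \<le> (fact j :: real)" using False by (intro fact_mono) simp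
          then have "2 * pi * (r * fact n) / fact j \<le> 2 * pi * (r * fact n) / fact (Suc n)"
            by (intro divide_left_mono) auto
          also have "\<dots> = 2 * pi * (r / real (Suc n))" by (simp add: divide_simps del: of_nat_Suc)
          also have "\<dots> \<le> 2 * pi * \<rho>" using r by (intro mult_left_mono) (auto simp: field_simps)
          finally show ?thesis
            using norm_cis_minus_1[of "2 * pi * (r * fact n) / fact j"] \<rho>(3) by (simp add: c_zmul)
        qed (use c_fact e0(1) in simp)
        moreover have "norm (c j ?y - 1) \<le> e" if "j < N" for j
          using c_fact[of j n r] n that N(1) by simp
        moreover have "\<phi> ?y = w n ^ r"
          using character_zmul[OF ch, of "int r" "zmul (int (fact n)) x"] by (simp add: zmul_zmul w_def)
        ultimately show ?thesis using N(2)[of ?y] by (simp add: H_def)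
      qed
      obtain N1 :: nat where N1: "2 / \<rho> < real N1" using reals_Archimedean2 by blast
      \<comment> \<open>\<open>N\<close> serves \<open>w_power\<close>, \<open>N1\<close> makes
        \<open>\<rho> * (n + 1) > 2\<close> so that rounding down loses at most half, and 3 makes
        the growth factor \<open>Suc n / 2\<close> at least 2.\<close>
      define n0 where "n0 = N + N1 + 3"
      have w_small: "(real n + 1) * norm (w n - 1) \<le> 1 / 2" if n: "n \<ge> n0" for n
      proof -
        define R where "R = nat \<lfloor>\<rho> * (real n + 1)\<rfloor>"
        have "real N1 \<le> real n + 1" using n by (simp add: n0_def)
        then have "2 / \<rho> < real n + 1" using N1 by linarith
        then have "2 < \<rho> * (real n + 1)" using \<rho>(1) by (simp add: field_simps)
        then have R: "real R \<le> \<rho> * (real n + 1)" "\<rho> * (real n + 1) / 2 \<le> real R"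
          unfolding R_def by linarith+
        have powers: "norm (w n ^ r - 1) \<le> \<rho> / 8" if "r \<le> R" for r
        proof (rule w_power)
          show "n \<ge> N" using n by (simp add: n0_def)
          have "real r \<le> real R" using that by simp
          also note R(1)
          finally show "real r \<le> \<rho> * real (n + 1)" by (simp add: add.commute)
        qed
        have "norm (w n ^ r - 1) \<le> 1 / 2" if "r < R" for r
          using powers[of r] that \<rho>(2) by simp
        then have "R / 2 * norm (w n - 1) \<le> norm (w n ^ R - 1)" by (rule power_minus_1_growth)
        also have "\<dots> \<le> \<rho> / 8" by (rule powers) simp
        finally have "R / 2 * norm (w n - 1) \<le> \<rho> / 8" .
        moreover have "\<rho> * (real n + 1) / 2 / 2 * norm (w n - 1) \<le> R / 2 * norm (w n - 1)"
          using R(2) by (intro mult_right_mono) auto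
        ultimately have "\<rho> * ((real n + 1) * norm (w n - 1)) \<le> \<rho> * (1 / 2)" by simp
        then show ?thesis using \<rho>(1) by (simp only: mult_le_cancel_left_pos)
      qed
      have w_grow: "2 * norm (w n - 1) \<le> norm (w (Suc n) - 1)" if n: "n \<ge> n0" for n
      proof -
        have "norm (w n ^ r - 1) \<le> 1 / 2" if "r < Suc n" for r
        proof -
          have "norm (w n ^ r - 1) \<le> r * norm (w n - 1)" by (rule norm_power_minus_1_le[OF norm_w])
          also have "\<dots> \<le> (real n + 1) * norm (w n - 1)" using that by (intro mult_right_mono) auto
          finally show ?thesis using w_small[OF n] by linarith
        qed
        then have "Suc n / 2 * norm (w n - 1) \<le> norm (w (Suc n) - 1)"
          unfolding w_Suc by (rule power_minus_1_growth)
        moreover have "2 * norm (w n - 1) \<le> Suc n / 2 * norm (w n - 1)"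
          using n by (intro mult_right_mono) (auto simp: n0_def)
        ultimately show ?thesis by linarith
      qed
      have "2 ^ i * norm (w n0 - 1) \<le> norm (w (n0 + i) - 1)" for i
      proof (induction i)
        case (Suc i)
        then show ?case using w_grow[of "n0 + i"] by simp
      qed simp
      moreover have "norm (w n - 1) \<le> 2" for n
        unfolding w_def by (rule character_1_le_2[OF ch])
      ultimately have bnd: "2 ^ i * norm (w n0 - 1) \<le> 2" for i by (meson order_trans)
      have "w n0 = 1"
      proof (rule ccontr)
        assume "w n0 \<noteq> 1"
        then have pos: "norm (w n0 - 1) > 0" by simp
        obtain i where "2 / norm (w n0 - 1) < 2 ^ i" using real_arch_pow[of 2] by auto
        then show False using bnd[of i] pos by (simp add: field_simps)
      qed
      \<comment> \<open>The coordinate \<open>c n0 y\<close> is a \<open>fact n0\<close>-th root of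
        unity; being this close to 1 it equals 1. Hence \<open>y\<close> is a multiple of
        \<open>zmul (int (fact n0)) x\<close>, where \<open>\<phi>\<close> is trivial.\<close>
      have "norm (\<phi> y - 1) \<le> d" if y: "y \<in> H" "\<And>n. n < Suc n0 \<Longrightarrow> norm (c n y - 1) \<le> 1 / (2 * fact n0)"
        and d: "d > 0" for y d
      proof -
        obtain k where k: "y = zmul k x" using y(1) by (auto simp: H_def)
        let ?z = "c n0 y"
        have nz: "norm ?z = 1" by (simp add: character_norm char_c)
        have "?z ^ fact n0 = c n0 (zmul (int (fact n0) * k) x)"
          using character_zmul[OF char_c, of n0 "int (fact n0)" y]
          by (simp only: k zmul_zmul power_int_of_nat)
        also have "\<dots> = 1" unfolding c_eq_1 by simp
        finally have z1: "?z ^ fact n0 = 1" .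
        have "norm (?z ^ r - 1) \<le> 1 / 2" if "r < fact n0" for r :: nat
        proof -
          have "norm (?z ^ r - 1) \<le> r * norm (?z - 1)" by (rule norm_power_minus_1_le[OF nz])
          also have "\<dots> \<le> fact n0 * (1 / (2 * fact n0))"
          proof (rule mult_mono)
            show "real r \<le> fact n0" using that by (metis less_imp_le of_nat_fact of_nat_le_iff)
          qed (use y(2) in auto)
          finally show ?thesis by simp
        qed
        then have "fact n0 / 2 * norm (?z - 1) \<le> 0"
          using power_minus_1_growth[of "fact n0" ?z] by (simp add: z1)
        moreover have "fact n0 / 2 > (0::real)" by simp
        ultimately have "norm (?z - 1) \<le> 0" by (simp only: mult_le_0_iff) linarith
        then have "?z = 1" by simp
        then obtain m where "k = int (fact n0) * m" using c_eq_1 k by auto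
        then have "\<phi> y = w n0 powi m"
          using character_zmul[OF ch, of m "zmul (int (fact n0)) x"]
          by (simp add: k zmul_zmul w_def mult.commute)
        then show ?thesis using \<open>w n0 = 1\<close> d by simp
      qed
      then show ?thesis unfolding pointwise_continuous_char_def
        by (metis fact_gt_zero zero_less_divide_1_iff zero_less_mult_iff zero_less_numeral)
    qed
  qed simp
qed

subsection \<open>Unbounded torsion groups\<close>

definition bounded_subgrp :: "'a::ab_group_add set \<Rightarrow> bool" where
  "bounded_subgrp H \<longleftrightarrow> subgrp H \<and> (\<exists>m::nat. m > 0 \<and> (\<forall>h\<in>H. zmul (int m) h = 0))"

definition order_modulo :: "'a::ab_group_add set \<Rightarrow> 'a \<Rightarrow> nat \<Rightarrow> bool" where
  "order_modulo H x q \<longleftrightarrow> q > 0 \<and> zmul (int q) x \<in> H \<and>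
     (\<forall>k::nat. 0 < k \<and> k < q \<longrightarrow> zmul (int k) x \<notin> H)"

lemma bounded_subgrp_span1:
  assumes H: "bounded_subgrp H" and n: "n > 0" "zmul (int n) x = 0"
  shows "bounded_subgrp (span1 H x)"
proof -
  obtain m :: nat where m: "m > 0" "\<And>h. h \<in> H \<Longrightarrow> zmul (int m) h = 0" and sg: "subgrp H"
    using H by (auto simp: bounded_subgrp_def)
  have "zmul (int (m * n)) y = 0" if y: "y \<in> span1 H x" for y
  proof -
    obtain h k where hk: "y = h + zmul k x" "h \<in> H" using y by (auto simp: span1_def)
    have "zmul (int (m * n)) h = zmul (int n) (zmul (int m) h)" by (simp add: zmul_zmul mult.commute)
    moreover have "zmul (int (m * n)) (zmul k x) = zmul (int m * k) (zmul (int n) x)"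
      by (simp add: zmul_zmul mult_ac)
    ultimately show ?thesis using hk m n by (simp add: zmul_right_add)
  qed
  then show ?thesis using subgrp_span1[OF sg] m(1) n(1)
    unfolding bounded_subgrp_def by (metis nat_0_less_mult_iff)
qed

text \<open>Take \<open>x\<close> not annihilated by \<open>m * fact N\<close>, where
  \<open>m\<close> annihilates \<open>H\<close>. If \<open>zmul (int k) x\<close> were in
  \<open>H\<close> with \<open>0 < k \<le> N\<close>, so would be
  \<open>zmul (int (fact N)) x\<close>, and \<open>m\<close> would kill it.\<close>

lemma large_order_modulo:
  assumes H: "bounded_subgrp (H :: 'a::ab_group_add set)"
    and torsion: "\<And>x::'a. \<exists>k::nat. k > 0 \<and> zmul (int k) x = 0"
    and unbounded: "\<And>m::nat. m > 0 \<Longrightarrow> \<exists>x::'a. zmul (int m) x \<noteq> 0"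
  shows "\<exists>x q. N < q \<and> order_modulo H x q"
proof -
  obtain m :: nat where m: "m > 0" "\<And>h. h \<in> H \<Longrightarrow> zmul (int m) h = 0" and sg: "subgrp H"
    using H by (auto simp: bounded_subgrp_def)
  obtain x :: 'a where x: "zmul (int (m * fact N)) x \<noteq> 0" using unbounded[of "m * fact N"] m(1) by auto
  have large: "zmul (int k) x \<notin> H" if k: "0 < k" "k \<le> N" for k
  proof
    assume "zmul (int k) x \<in> H"
    moreover obtain l where "fact N = k * l" using dvd_fact[of k N] k by (auto simp: dvd_def)
    ultimately have "zmul (int (fact N)) x \<in> H"
      using subgrp_zmul[OF sg, of "zmul (int k) x" "int l"] by (simp add: zmul_zmul mult.commute)
    then show False using m(2) x by (fastforce simp: zmul_zmul)
  qed
  have ex: "\<exists>k::nat. k > 0 \<and> zmul (int k) x \<in> H" using torsion[of x] subgrp_0[OF sg] by auto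
  define q where "q = (LEAST k::nat. k > 0 \<and> zmul (int k) x \<in> H)"
  have q: "q > 0" "zmul (int q) x \<in> H" using LeastI_ex[OF ex] by (auto simp: q_def)
  have least: "zmul (int k) x \<notin> H" if "0 < k" "k < q" for k
    using not_less_Least[of k "\<lambda>k. k > 0 \<and> zmul (int k) x \<in> H"] that by (auto simp: q_def)
  have "N < q" using large[of q] q by (meson not_le)
  then show ?thesis using q least unfolding order_modulo_def by blast
qed

text \<open>The \<open>q\<close>-th roots of \<open>u\<close> are equally spaced with angle
  \<open>2 * pi / q\<close>.\<close>

lemma root_near:
  assumes u: "norm (u::complex) = 1" and q: "q > (0::nat)"
  shows "\<exists>w. w ^ q = u \<and> norm (w - cis t) \<le> 2 * pi / q"
proof (intro exI conjI)
  \<comment> \<open>\<open>y\<close> is the real index at which the angle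
    \<open>(Arg u + 2 * pi * y) / q\<close> equals \<open>t\<close>; rounding it down gives an
    actual root.\<close>
  define y where "y = (q * t - Arg u) / (2 * pi)"
  define s where "s = (Arg u + 2 * pi * \<lfloor>y\<rfloor>) / q"
  have "cis s ^ q = cis (Arg u) * cis (2 * pi * \<lfloor>y\<rfloor>)"
    using q by (simp add: Complex.DeMoivre s_def flip: cis_mult)
  then show "cis s ^ q = u" using u by (simp add: circle_cis_Arg)
  have t: "t = (Arg u + 2 * pi * y) / q" using q by (simp add: y_def)
  have "\<bar>s - t\<bar> = 2 * pi * \<bar>of_int \<lfloor>y\<rfloor> - y\<bar> / q"
    unfolding s_def by (subst t) (simp add: abs_mult flip: diff_divide_distrib right_diff_distrib)
  also have "\<dots> \<le> 2 * pi * 1 / q"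
    by (intro divide_right_mono mult_left_mono) (linarith | simp)+
  finally show "norm (cis s - cis t) \<le> 2 * pi / q" using norm_cis_diff[of s t] by simp
qed

section \<open>Characters along a chain of subgroups with growing relative orders\<close>

locale torsion_chain =
  fixes Hs :: "nat \<Rightarrow> 'a::ab_group_add set" and xs :: "nat \<Rightarrow> 'a" and qs :: "nat \<Rightarrow> nat"
  assumes Hs_0: "Hs 0 = {0}" and Hs_Suc: "\<And>n. Hs (Suc n) = span1 (Hs n) (xs n)"
    and qs_large: "\<And>n. n < qs n" and order_xs: "\<And>n. order_modulo (Hs n) (xs n) (qs n)"
begin

lemma subgrp_Hs: "subgrp (Hs n)"
  by (induction n) (auto simp: Hs_0 Hs_Suc subgrp_span1, simp add: subgrp_def)

lemma Hs_mono: "m \<le> n \<Longrightarrow> Hs m \<subseteq> Hs n"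
  by (rule lift_Suc_mono_le[of Hs]) (simp_all add: Hs_Suc span1_superset)

lemma xs_mem: "xs n \<in> Hs (Suc n)"
  by (simp add: Hs_Suc span1_mem subgrp_0 subgrp_Hs)

lemma extend_by_root:
  assumes R: "char_graph R" "Domain R = Hs n" and u: "(zmul (int (qs n)) (xs n), u) \<in> R"
    and w: "w ^ qs n = u"
  shows "\<exists>S. char_graph S \<and> Domain S = Hs (Suc n) \<and> R \<subseteq> S \<and> (xs n, w) \<in> S"
proof -
  have "zmul (int k) (xs n) \<notin> Domain R" if "0 < k" "k < qs n" for k
    using order_xs[of n] that R(2) by (auto simp: order_modulo_def)
  moreover have "0 < qs n" using order_xs[of n] by (simp add: order_modulo_def)
  ultimately obtain S where "char_graph S" "R \<subseteq> S" "(xs n, w) \<in> S" "Domain S = span1 (Domain R) (xs n)"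
    using char_graph_extend_root[OF R(1) _ u _ w] by metis
  then show ?thesis using R(2) Hs_Suc by auto
qed

text \<open>At each stage the value at \<open>xs n\<close> may be any \<open>qs n\<close>-th root of
  a given number, and one of them is near the target. The union of the graphs is then extended to
  the whole group.\<close>

lemma extend_near_targets:
  assumes R: "char_graph R" "Domain R = Hs m"
  obtains \<psi> where "character \<psi>" "\<And>x z. (x, z) \<in> R \<Longrightarrow> \<psi> x = z"
    "\<And>n. n \<ge> m \<Longrightarrow> norm (\<psi> (xs n) - cis (t n)) \<le> 2 * pi / qs n"
proof -
  have "\<exists>f. \<forall>i. (char_graph (f i) \<and> Domain (f i) = Hs (m + i) \<and> R \<subseteq> f i) \<and>
    (f i \<subseteq> f (Suc i) \<and> (\<exists>w. (xs (m + i), w) \<in> f (Suc i) \<and> norm (w - cis (t (m + i))) \<le> 2 * pi / qs (m + i)))"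
  proof (rule dependent_nat_choice)
    show "\<exists>S. char_graph S \<and> Domain S = Hs (m + 0) \<and> R \<subseteq> S" using R by auto
    fix S i assume S: "char_graph S \<and> Domain S = Hs (m + i) \<and> R \<subseteq> S"
    let ?n = "m + i"
    have q: "qs ?n > 0" "zmul (int (qs ?n)) (xs ?n) \<in> Domain S"
      using order_xs[of ?n] S by (auto simp: order_modulo_def)
    then obtain u where u: "(zmul (int (qs ?n)) (xs ?n), u) \<in> S" by auto
    obtain w where w: "w ^ qs ?n = u" "norm (w - cis (t ?n)) \<le> 2 * pi / qs ?n"
      using root_near[OF char_graphD(2)[OF _ u] q(1)] S by blast
    show "\<exists>T. (char_graph T \<and> Domain T = Hs (m + Suc i) \<and> R \<subseteq> T) \<and>
        (S \<subseteq> T \<and> (\<exists>w. (xs ?n, w) \<in> T \<and> norm (w - cis (t ?n)) \<le> 2 * pi / qs ?n))"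
      using extend_by_root[OF _ _ u w(1)] S w(2) by (metis add_Suc_right order_trans)
  qed
  then obtain f where f: "\<And>i. char_graph (f i)" "\<And>i. R \<subseteq> f i" "\<And>i. f i \<subseteq> f (Suc i)"
    "\<And>i. \<exists>w. (xs (m + i), w) \<in> f (Suc i) \<and> norm (w - cis (t (m + i))) \<le> 2 * pi / qs (m + i)"
    by metis
  have mono: "f i \<subseteq> f j" if "i \<le> j" for i j using lift_Suc_mono_le[of f] f(3) that by blast
  have "char_graph (\<Union>(range f))"
  proof (rule char_graph_Union)
    show "subset.chain UNIV (range f)"
      unfolding subset_chain_def
    proof (intro conjI ballI)
      fix X Y assume "X \<in> range f" "Y \<in> range f"
      then obtain i j where "X = f i" "Y = f j" by blast
      then show "X \<subseteq> Y \<or> Y \<subseteq> X" using mono[of i j] mono[of j i] nat_le_linear[of i j] by blast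
    qed simp
  qed (use f(1) in auto)
  then obtain \<psi> where \<psi>: "character \<psi>" "\<And>x z. (x, z) \<in> \<Union>(range f) \<Longrightarrow> \<psi> x = z"
    using char_graph_total by blast
  have "norm (\<psi> (xs n) - cis (t n)) \<le> 2 * pi / qs n" if "n \<ge> m" for n
  proof -
    obtain w where "(xs n, w) \<in> f (Suc (n - m))" "norm (w - cis (t n)) \<le> 2 * pi / qs n"
      using f(4)[of "n - m"] \<open>n \<ge> m\<close> by auto
    then show ?thesis using \<psi>(2)[of "xs n" w] by blast
  qed
  then show ?thesis using that[of \<psi>] \<psi> f(2) by blast
qed

text \<open>
  Every finite rational pattern of angles occurs as the target vector for infinitely many \<open>n\<close>.
\<close>

definition target :: "nat \<Rightarrow> nat \<Rightarrow> real" where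
  "target j n = (let l = fst (from_nat n :: rat list \<times> nat) in if j < length l then of_rat (l ! j) else 0)"

text \<open>The primitive root of unity at \<open>xs j\<close> makes the kernel on
  \<open>Hs (Suc j)\<close> exactly \<open>Hs j\<close>, so that these characters separate points.
  The targets at later generators serve density.\<close>

lemma character_with_targets:
  "\<exists>\<psi>. character \<psi> \<and> (\<forall>x\<in>Hs j. \<psi> x = 1) \<and> \<psi> (xs j) = cis (2 * pi / qs j) \<and>
    (\<forall>n>j. norm (\<psi> (xs n) - cis (target j n)) \<le> 2 * pi / qs n)"
proof -
  have q: "qs j > 0" "zmul (int (qs j)) (xs j) \<in> Hs j"
    using order_xs[of j] by (auto simp: order_modulo_def)
  then have w: "cis (2 * pi / qs j) ^ qs j = 1" by (simp add: Complex.DeMoivre)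
  obtain S where S: "char_graph S" "Domain S = Hs (Suc j)" "Hs j \<times> {1} \<subseteq> S" "(xs j, cis (2 * pi / qs j)) \<in> S"
  proof -
    have "Domain (Hs j \<times> {1::complex}) = Hs j" by auto
    then have "\<exists>S. char_graph S \<and> Domain S = Hs (Suc j) \<and> Hs j \<times> {1} \<subseteq> S \<and> (xs j, cis (2 * pi / qs j)) \<in> S"
      by (rule extend_by_root[OF char_graph_trivial[OF subgrp_Hs] _ _ w]) (use q(2) in simp)
    then show ?thesis using that by blast
  qed
  obtain \<psi> where "character \<psi>" "\<And>x z. (x, z) \<in> S \<Longrightarrow> \<psi> x = z"
    "\<And>n. n \<ge> Suc j \<Longrightarrow> norm (\<psi> (xs n) - cis (target j n)) \<le> 2 * pi / qs n"
    using extend_near_targets[OF S(1,2), of "target j"] by blast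
  then show ?thesis using S(3,4) by (intro exI[of _ \<psi>]) (auto simp: Suc_le_eq)
qed

text \<open>For compatibility, divide the arguments of the coordinates of \<open>x\<close> by a
  fixed \<open>L\<close> and approximate the result by some \<open>y\<close> in \<open>H\<close>.
  Then \<open>y\<close> lies in the ball where \<open>\<phi>\<close> is pointwise continuous, and
  \<open>zmul (int L) y - x\<close> is uniformly small, so \<open>\<phi> x\<close> is close to
  \<open>\<phi> y ^ L\<close>, hence to 1.\<close>

lemma not_Mackey:
  "\<exists>\<tau> :: 'a topology. metrizable_space \<tau> \<and> locally_quasi_convex \<tau> \<and> \<not> Mackey \<tau>"
proof -
  obtain c where char_c: "\<And>j. character (c j)" and c_Hs: "\<And>j x. x \<in> Hs j \<Longrightarrow> c j x = 1"
    and c_xs: "\<And>j. c j (xs j) = cis (2 * pi / qs j)"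
    and c_target: "\<And>j n. j < n \<Longrightarrow> norm (c j (xs n) - cis (target j n)) \<le> 2 * pi / qs n"
    using character_with_targets by metis
  define H where "H = (\<Union>n. Hs n)"
  have Hs_H: "Hs n \<subseteq> H" for n by (auto simp: H_def)
  have "subgrp H" unfolding subgrp_def
  proof (intro conjI ballI)
    show "0 \<in> H" using Hs_H[of 0] Hs_0 by auto
    fix x y assume "x \<in> H" "y \<in> H"
    then obtain m n where "x \<in> Hs m" "y \<in> Hs n" by (auto simp: H_def)
    then have "x \<in> Hs (max m n)" "y \<in> Hs (max m n)"
      using Hs_mono[of m "max m n"] Hs_mono[of n "max m n"] by auto
    then show "x - y \<in> H" using subgrp_diff[OF subgrp_Hs] Hs_H by blast
  qed
  then interpret character_sequence H c using char_c by unfold_locales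
  \<comment> \<open>A single generator \<open>xs n\<close> suffices as \<open>y\<close>: its index
    encodes rational approximations of the angles \<open>t\<close>.\<close>
  have dense: "\<exists>y\<in>H. (\<forall>j<M. norm (c j y - cis (t j)) \<le> e) \<and> (\<forall>j\<ge>M. norm (c j y - 1) \<le> e)"
    if e: "e > 0" for t :: "nat \<Rightarrow> real" and M e
  proof -
    have "\<exists>r::rat. \<bar>of_rat r - t j\<bar> < e / 2" for j
    proof -
      obtain r where "t j - e / 2 < of_rat r" "of_rat r < t j + e / 2"
        using of_rat_dense[of "t j - e / 2" "t j + e / 2"] e by auto
      then show ?thesis by (intro exI[of _ r]) linarith
    qed
    then obtain g :: "nat \<Rightarrow> rat" where g: "\<And>j. \<bar>of_rat (g j) - t j\<bar> < e / 2" by metis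
    define l where "l = map g [0..<M]"
    obtain N :: nat where N: "4 * pi / e < real N" using reals_Archimedean2 by blast
    \<comment> \<open>The second component of the code makes the same list \<open>l\<close> occur at
      arbitrarily large \<open>n\<close>, where \<open>qs n\<close> is large and the error
      small.\<close>
    have "inj (\<lambda>k::nat. to_nat (l, k))" by (auto intro!: injI)
    then have "infinite (range (\<lambda>k::nat. to_nat (l, k)))" by (rule range_inj_infinite)
    then have "\<exists>n\<ge>max M N. n \<in> range (\<lambda>k::nat. to_nat (l, k))"
      unfolding infinite_nat_iff_unbounded_le by blast
    then obtain k :: nat where k: "to_nat (l, k) \<ge> max M N" by blast
    define n where "n = to_nat (l, k)"
    have n: "M \<le> n" "N \<le> n" using k by (auto simp: n_def)
    have target: "target j n = (if j < M then of_rat (g j) else 0)" for j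
      by (simp add: target_def n_def l_def)
    have q: "2 * pi / qs n \<le> e / 2"
    proof -
      have "4 * pi < e * real N" using N e by (simp add: field_simps)
      also have "\<dots> \<le> e * real (qs n)" using qs_large[of n] n(2) e by simp
      finally show ?thesis using qs_large[of n] by (simp add: field_simps)
    qed
    have "norm (c j (xs n) - cis (t j)) \<le> e" if j: "j < M" for j
    proof -
      have "norm (c j (xs n) - cis (of_rat (g j))) \<le> e / 2"
        using c_target[of j n] j n(1) q by (simp add: target)
      moreover have "norm (cis (of_rat (g j)) - cis (t j)) \<le> e / 2"
        using norm_cis_diff[of "of_rat (g j)" "t j"] g[of j] by linarith
      ultimately show ?thesis
        using norm_triangle_ineq[of "c j (xs n) - cis (of_rat (g j))" "cis (of_rat (g j)) - cis (t j)"] by simp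
    qed
    \<comment> \<open>Before \<open>n\<close> the target is 0, at \<open>n\<close> the value is a
      root of unity near 1, and after \<open>n\<close> it is exactly 1.\<close>
    moreover have "norm (c j (xs n) - 1) \<le> e" if j: "j \<ge> M" for j
    proof (cases j n rule: linorder_cases)
      case less
      then show ?thesis using c_target[OF less] q j e by (simp add: target)
    next
      case equal
      then show ?thesis using norm_cis_minus_1[of "2 * pi / qs n"] q e by (simp add: c_xs)
    next
      case greater
      then have "xs n \<in> Hs j" using xs_mem[of n] Hs_mono[of "Suc n" j] by auto
      then show ?thesis using c_Hs e by simp
    qed
    moreover have "xs n \<in> H" using xs_mem Hs_H by blast
    ultimately show ?thesis by blast
  qed
  have eventually_1: "\<exists>m. \<forall>j\<ge>m. c j x = 1" if "x \<in> H" for x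
    using that c_Hs Hs_mono unfolding H_def by blast
  show ?thesis
  proof (rule metrizable_not_Mackey)
    show "x = 0" if x: "x \<in> H" "\<And>n. c n x = 1" for x
    proof -
      \<comment> \<open>Descent along the chain: \<open>c n x = 1\<close> forces \<open>x\<close>
        from \<open>Hs (Suc n)\<close> into \<open>Hs n\<close>, down to
        \<open>Hs 0\<close>.\<close>
      have "x \<in> Hs n \<Longrightarrow> x = 0" for n
      proof (induction n)
        case 0
        then show ?case by (simp add: Hs_0)
      next
        case (Suc n)
        obtain h k where hk: "x = h + zmul k (xs n)" "h \<in> Hs n"
          using Suc.prems by (auto simp: Hs_Suc span1_def)
        have q: "qs n > 0" "zmul (int (qs n)) (xs n) \<in> Hs n"
          using order_xs[of n] by (auto simp: order_modulo_def)
        have "1 = cis (2 * pi * of_int k / qs n)"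
          using x(2)[of n] c_Hs[OF hk(2)]
          by (simp add: hk(1) character_add[OF char_c] character_zmul[OF char_c] c_xs cis_power_int mult_ac)
        then have "int (qs n) dvd k" using cis_root_eq_1_iff[OF q(1), of k] by simp
        then obtain m where "k = m * int (qs n)" by (metis dvd_def mult.commute)
        then have "zmul k (xs n) \<in> Hs n"
          using subgrp_zmul[OF subgrp_Hs q(2), of m] by (simp add: zmul_zmul)
        then show ?case using Suc.IH hk subgrp_add[OF subgrp_Hs] by simp
      qed
      then show ?thesis using x(1) by (auto simp: H_def)
    qed
    show "\<exists>x\<in>H. (\<forall>n<N. norm (c n x - 1) \<le> e) \<and> (\<exists>n. norm (c n x - 1) \<ge> 1)" if e: "e > 0" for N e
    proof -
      \<comment> \<open>Coordinate \<open>N\<close> is placed within 1 of -1, hence at distance at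
        least 1 from 1, and the earlier ones near 1.\<close>
      obtain y where y: "y \<in> H" "\<And>j. j < Suc N \<Longrightarrow> norm (c j y - cis (if j = N then pi else 0)) \<le> min e 1"
        using dense[of "min e 1" "Suc N" "\<lambda>j. if j = N then pi else 0"] e
        by (metis min_less_iff_conj zero_less_one)
      have "norm (c N y + 1) \<le> 1" using y(2)[of N] by simp
      then have "norm (c N y - 1) \<ge> 1"
        using norm_triangle_ineq4[of "c N y + 1" "c N y - 1"] by simp
      moreover have "norm (c n y - 1) \<le> e" if "n < N" for n using y(2)[of n] that by simp
      ultimately show ?thesis using y(1) by blast
    qed
    show "pointwise_continuous_char \<phi>" if ch: "character \<phi>" and uc: "uniformly_continuous_char \<phi>" for \<phi>
      unfolding pointwise_continuous_char_def
    proof (intro allI impI)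
      fix d :: real assume d: "d > 0"
      have null: "(\<lambda>n. c n x) \<longlonglongrightarrow> 1" if x: "x \<in> H" for x
      proof -
        have "\<forall>\<^sub>F n in sequentially. c n x = 1"
          using eventually_1[OF x] by (simp add: eventually_sequentially)
        then show ?thesis by (rule tendsto_eventually)
      qed
      obtain e0 where e0: "e0 > 0" "\<And>d. d > 0 \<Longrightarrow> \<exists>N. \<exists>e>0. \<forall>y\<in>H. (\<forall>n. norm (c n y - 1) \<le> e0) \<longrightarrow>
          (\<forall>n<N. norm (c n y - 1) \<le> e) \<longrightarrow> norm (\<phi> y - 1) \<le> d"
        using pointwise_continuous_on_ball[OF null ch uc] by metis
      obtain e1 where e1: "e1 > 0"
        "\<And>x. x \<in> H \<Longrightarrow> (\<And>n. norm (c n x - 1) \<le> e1) \<Longrightarrow> norm (\<phi> x - 1) \<le> d / 2"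
        using uc d unfolding uniformly_continuous_char_def by (metis half_gt_zero)
      \<comment> \<open>Angles in \<open>[-pi, pi]\<close> divided by \<open>L\<close> have modulus
        at most \<open>e0 / 2\<close>.\<close>
      obtain L :: nat where L: "2 * pi / e0 < real L" using reals_Archimedean2 by blast
      then have L0: "real L > 0" using e0(1) by (metis divide_pos_pos less_trans mult_pos_pos pi_gt_zero zero_less_numeral)
      have piL: "pi / L \<le> e0 / 2" using L L0 e0(1) by (simp add: field_simps)
      have "d / (2 * L) > 0" using d L0 by simp
      from e0(2)[OF this] obtain N e where N: "e > 0" "\<And>y. y \<in> H \<Longrightarrow> (\<And>n. norm (c n y - 1) \<le> e0) \<Longrightarrow>
          (\<And>n. n < N \<Longrightarrow> norm (c n y - 1) \<le> e) \<Longrightarrow> norm (\<phi> y - 1) \<le> d / (2 * L)"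
        by blast
      \<comment> \<open>The three bounds serve the first \<open>N\<close> coordinates of
        \<open>y\<close>, its uniform distance \<open>e0\<close>, and the error of its
        \<open>L\<close>-th power, which is at most \<open>L * f\<close>.\<close>
      define f where "f = min (min e (e0 / 2)) (e1 / (2 * L))"
      have f: "f > 0" "f \<le> e" "f \<le> e0 / 2" "f \<le> e1 / (2 * L)"
        using N(1) e0(1) e1(1) L0 by (auto simp: f_def)
      then have fL: "L * f \<le> e1 / 2" using L0 by (simp add: field_simps)
      have "norm (\<phi> x - 1) \<le> d" if x: "x \<in> H" "\<And>n. n < N \<Longrightarrow> norm (c n x - 1) \<le> e1 / 2" for x
      proof -
        obtain m where m: "\<And>j. j \<ge> m \<Longrightarrow> c j x = 1" using eventually_1[OF x(1)] by blast
        \<comment> \<open>The first \<open>N\<close> angles are 0, so that \<open>y\<close>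
          satisfies the pointwise condition; there \<open>x\<close> itself is within
          \<open>e1 / 2\<close> of 1.\<close>
        define t where "t j = (if j < N then 0 else Arg (c j x) / L)" for j
        obtain y where y: "y \<in> H" "\<And>j. j < max m N \<Longrightarrow> norm (c j y - cis (t j)) \<le> f"
          "\<And>j. j \<ge> max m N \<Longrightarrow> norm (c j y - 1) \<le> f"
          using dense[OF f(1), of "max m N" t] by blast
        have near: "norm (c j y - cis (t j)) \<le> f" for j
        proof (cases "j < max m N")
          case False
          then have j: "max m N \<le> j" by (simp only: not_less)
          then have "t j = 0" using m[of j] by (simp add: t_def)
          then show ?thesis using y(3)[OF j] by simp
        qed (rule y(2))
        have "norm (\<phi> y - 1) \<le> d / (2 * L)"
        proof (rule N(2)[OF y(1)])
          show "norm (c j y - 1) \<le> e" if "j < N" for j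
            using near[of j] that f(2) by (simp add: t_def)
          show "norm (c j y - 1) \<le> e0" for j
          proof -
            have "\<bar>t j\<bar> \<le> pi / L"
              using Arg_bounded[of "c j x"] L0 by (auto simp: t_def divide_right_mono)
            then have "norm (cis (t j) - 1) \<le> e0 / 2" using norm_cis_minus_1[of "t j"] piL by linarith
            then show ?thesis
              using norm_triangle_ineq[of "c j y - cis (t j)" "cis (t j) - 1"] near[of j] f(3) by simp
          qed
        qed
        then have "L * norm (\<phi> y - 1) \<le> d / 2" using L0 by (simp add: field_simps)
        then have "norm (\<phi> y ^ L - 1) \<le> d / 2"
          using norm_power_minus_1_le[OF character_norm[OF ch], of y L] by linarith
        moreover have "norm (\<phi> (zmul (int L) y - x) - 1) \<le> d / 2"
        proof (rule e1(2))
          show "zmul (int L) y - x \<in> H"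
            using subgrp_H subgrp_diff subgrp_zmul x(1) y(1) by blast
          show "norm (c j (zmul (int L) y - x) - 1) \<le> e1" for j
          proof -
            have "norm (c j y ^ L - cis (t j) ^ L) \<le> L * f"
              using norm_power_diff[of "c j y" "cis (t j)" L] mult_left_mono[OF near[of j], of "real L"]
              by (simp add: character_norm[OF char_c])
            moreover have "norm (cis (t j) ^ L - c j x) \<le> e1 / 2"
            proof (cases "j < N")
              case True
              then show ?thesis using x(2)[of j] by (simp add: t_def norm_minus_commute)
            next
              case False
              then have "cis (t j) ^ L = c j x"
                using L0 by (simp add: t_def Complex.DeMoivre circle_cis_Arg character_norm[OF char_c])
              then show ?thesis using e1(1) by simp
            qed
            ultimately have "norm (c j y ^ L - c j x) \<le> e1"
              using norm_triangle_ineq[of "c j y ^ L - cis (t j) ^ L" "cis (t j) ^ L - c j x"] fL by simp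
            then show ?thesis
              by (simp add: character_diff_1[OF char_c] character_zmul[OF char_c])
          qed
        qed
        ultimately show ?thesis
          using norm_triangle_ineq4[of "\<phi> y ^ L - 1" "\<phi> y ^ L - \<phi> x"]
          by (simp add: character_diff_1[OF ch] character_zmul[OF ch])
      qed
      then show "\<exists>N. \<exists>e>0. \<forall>x\<in>H. (\<forall>n<N. norm (c n x - 1) \<le> e) \<longrightarrow> norm (\<phi> x - 1) \<le> d"
        using e1(1) by (intro exI[of _ N] exI[of _ "e1 / 2"]) auto
    qed
  qed simp
qed

end

lemma unbounded_torsion_not_Mackey:
  assumes torsion: "\<And>x::'a::ab_group_add. \<exists>k::nat. k > 0 \<and> zmul (int k) x = 0"
    and unbounded: "\<And>m::nat. m > 0 \<Longrightarrow> \<exists>x::'a. zmul (int m) x \<noteq> 0"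
  shows "\<exists>\<tau> :: 'a topology. metrizable_space \<tau> \<and> locally_quasi_convex \<tau> \<and> \<not> Mackey \<tau>"
proof -
  \<comment> \<open>Boundedness of \<open>K n\<close> is the invariant that supplies an element of
    large relative order at every stage; torsion preserves it.\<close>
  have "\<exists>K. \<forall>n. (bounded_subgrp (K n) \<and> (n = 0 \<longrightarrow> K n = {0})) \<and>
    (\<exists>x::'a. \<exists>q. n < q \<and> order_modulo (K n) x q \<and> K (Suc n) = span1 (K n) x)"
  proof (rule dependent_nat_choice)
    have "bounded_subgrp {0::'a}" by (auto simp: bounded_subgrp_def subgrp_def)
    then show "\<exists>K::'a set. bounded_subgrp K \<and> ((0::nat) = 0 \<longrightarrow> K = {0})" by blast
    fix K :: "'a set" and n :: nat assume "bounded_subgrp K \<and> (n = 0 \<longrightarrow> K = {0})"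
    then have K: "bounded_subgrp K" by blast
    obtain x q where x: "n < q" "order_modulo K x q"
      using large_order_modulo[OF K torsion unbounded, of n] by blast
    obtain k :: nat where "k > 0" "zmul (int k) x = 0" using torsion by blast
    then have "bounded_subgrp (span1 K x)" by (rule bounded_subgrp_span1[OF K])
    then show "\<exists>L. (bounded_subgrp L \<and> (Suc n = 0 \<longrightarrow> L = {0})) \<and>
        (\<exists>x q. n < q \<and> order_modulo K x q \<and> L = span1 K x)"
      using x by blast
  qed
  then obtain K where K: "\<forall>n. (bounded_subgrp (K n) \<and> (n = 0 \<longrightarrow> K n = {0})) \<and>
    (\<exists>x::'a. \<exists>q. n < q \<and> order_modulo (K n) x q \<and> K (Suc n) = span1 (K n) x)" ..
  have K0: "K 0 = {0}" using spec[OF K, of 0] by simp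
  have "\<forall>n. \<exists>p. n < snd p \<and> order_modulo (K n) (fst p) (snd p) \<and> K (Suc n) = span1 (K n) (fst p)"
    using K by simp
  then obtain p where p: "\<And>n. n < snd (p n)" "\<And>n. order_modulo (K n) (fst (p n)) (snd (p n))"
    "\<And>n. K (Suc n) = span1 (K n) (fst (p n))"
    using choice by metis
  interpret torsion_chain K "\<lambda>n. fst (p n)" "\<lambda>n. snd (p n)"
    by unfold_locales (fact K0 p)+
  show ?thesis by (rule not_Mackey)
qed

theorem theoremC:
  assumes "\<not> bounded_group TYPE('a::ab_group_add)"
  shows "\<exists>\<tau> :: 'a topology. metrizable_space \<tau> \<and> locally_quasi_convex \<tau> \<and> \<not> Mackey \<tau>"
proof (cases "\<exists>x::'a. \<forall>k. zmul k x = 0 \<longrightarrow> k = 0")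
  case True
  then show ?thesis using infinite_order_not_Mackey by blast
next
  case False
  have "\<exists>k::nat. k > 0 \<and> zmul (int k) x = 0" for x :: 'a
  proof -
    obtain k where k: "k \<noteq> 0" "zmul k x = 0" using False by blast
    then have "zmul (int (nat \<bar>k\<bar>)) x = 0" by (simp add: abs_if zmul_minus)
    then show ?thesis using k(1) by (intro exI[of _ "nat \<bar>k\<bar>"]) simp
  qed
  moreover have "\<exists>x::'a. zmul (int m) x \<noteq> 0" if "m > 0" for m :: nat
    using assms that unfolding bounded_group_def zmul_of_nat by blast
  ultimately show ?thesis by (rule unbounded_torsion_not_Mackey)
qed

end
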